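(* Assume the Riemann Hypothesis. Let $0<\gamma_-<\gamma_+$ be two consecutive simple positive zeros of $\Xi(t)$ and let $\Delta=\gamma_+-\gamma_-$. If $$\Delta^2\left(-P\Xi^\prime(\gamma_+)-P\Xi^\prime(\gamma_-)\right)<\frac{42}{5}$$ (that is, $\{\gamma_-,\gamma_+\}$ is a strong Lehmer pair), then $\{\gamma_-,\gamma_+\}$ is a Lehmer pair, i.e. $\Delta^2 g<\frac45$, where $$g=\sum_{\gamma\ne\gamma_-,\gamma_+}\left(\frac{1}{(\gamma-\gamma_-)^2}+\frac{1}{(\gamma-\gamma_+)^2}\right).$$
   Context: The Riemann xi functions are $\xi(s)=\frac12 s(s-1)\pi^{-s/2}\Gamma(s/2)\zeta(s)$ and $\Xi(t)=\xi(1/2+it)$. The Riemann Hypothesis (all zeros of $\Xi$ are real) is assumed throughout. In the sum defining $g$, $\gamma$ runs over all zeros of $\Xi$ (positive and negative, counted with multiplicity) other than $\gamma_-$ and $\gamma_+$. For an analytic function $f$, the pre-Schwarzian is $Pf(z)=\dfrac{f''(z)}{f'(z)}$. By convention $P$ has priority over the derivative: $Pf^\prime(z)$ means $\left(\dfrac{f''(z)}{f'(z)}\right)^\prime$ (the derivative of $Pf$), not $f'''(z)/f''(z)$. Definitions: with $\gamma_\pm$, $\Delta$, $g$ as in the claim, $\{\gamma_-,\gamma_+\}$ is a Lehmer pair if $\Delta^2 g<4/5$, and a strong Lehmer pair if $\Delta^2(-P\Xi^\prime(\gamma_+)-P\Xi^\prime(\gamma_-))<42/5$. *)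

theory Defs
  imports "HOL-Complex_Analysis.Complex_Analysis"
begin

(* The analytic continuation of the Dirichlet series; it is unique because the complement of {1}
   is connected, up to the value at the pole 1, which is fixed to be 0. *)
definition riemann_zeta :: "complex \<Rightarrow> complex" where
  "riemann_zeta = (THE f. f holomorphic_on - {1} \<and>
     (\<forall>s. Re s > 1 \<longrightarrow> f s = (\<Sum>n. 1 / of_nat (Suc n) powr s)) \<and> f 1 = 0)"

(* The formula is only valid off the removable singularities s = 1 and s = 0, -2, -4, ..., where
   zeta or Gamma has a pole; there the library functions take the value 0, so without
   remove_sings these points would become spurious zeros. *)
definition riemann_xi :: "complex \<Rightarrow> complex" where
  "riemann_xi = remove_sings
     (\<lambda>s. 1/2 * s * (s - 1) * of_real pi powr (- s / 2) * Gamma (s / 2) * riemann_zeta s)"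

definition riemann_Xi :: "complex \<Rightarrow> complex" where
  "riemann_Xi t = riemann_xi (1/2 + \<i> * t)"

definition Riemann_Hypothesis :: bool where
  "Riemann_Hypothesis \<longleftrightarrow> (\<forall>z. riemann_Xi z = 0 \<longrightarrow> z \<in> \<real>)"

definition pre_schwarzian :: "(complex \<Rightarrow> complex) \<Rightarrow> complex \<Rightarrow> complex" where
  "pre_schwarzian f z = deriv (deriv f) z / deriv f z"

definition other_zeros :: "real \<Rightarrow> real \<Rightarrow> complex set" where
  "other_zeros a b = {z. riemann_Xi z = 0} - {of_real a, of_real b}"

(* Multiplicities enter as the weight zorder. *)
definition lehmer_term :: "real \<Rightarrow> real \<Rightarrow> complex \<Rightarrow> complex" where
  "lehmer_term a b z =
     of_int (zorder riemann_Xi z) * (1 / (z - of_real a)^2 + 1 / (z - of_real b)^2)"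

definition lehmer_g :: "real \<Rightarrow> real \<Rightarrow> complex" where
  "lehmer_g a b = (\<Sum>\<^sub>\<infinity>z\<in>other_zeros a b. lehmer_term a b z)"

(* Under the Riemann Hypothesis all terms are real, so Re only changes the type.  Summability is
   part of the definition since infsum is 0 for a divergent sum. *)
definition lehmer_pair :: "real \<Rightarrow> real \<Rightarrow> bool" where
  "lehmer_pair a b \<longleftrightarrow>
     lehmer_term a b summable_on other_zeros a b \<and>
     (b - a)^2 * Re (lehmer_g a b) < 4/5"

(* Xi is real on the real axis, hence so are its derivatives and Re only changes the type. *)
definition strong_lehmer_pair :: "real \<Rightarrow> real \<Rightarrow> bool" where
  "strong_lehmer_pair a b \<longleftrightarrow>
     (b - a)^2 * Re (- deriv (pre_schwarzian riemann_Xi) (of_real b)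
                     - deriv (pre_schwarzian riemann_Xi) (of_real a)) < 42/5"

end

theory Submission
  imports Defs "HOL-Probability.Probability" "HOL-Real_Asymp.Real_Asymp"
begin

text \<open>
  At a simple zero \<open>a\<close> write \<open>\<Xi>(z) = (z - a) h(z)\<close>. Expanding the first three derivatives of
  \<open>\<Xi>\<close> at \<open>a\<close> in terms of \<open>h\<close> gives \<open>P\<Xi>'(a) = 3 (h'/h)'(a) - L\<^sup>2\<close> with
  \<open>L = \<Xi>''(a) / (2 \<Xi>'(a))\<close>, and \<open>L\<close> is real because \<open>\<Xi>\<close> is real on the real axis. Since \<open>\<Xi>\<close> has
  order less than two, \<open>-(h'/h)'(a)\<close> is the sum of \<open>1 / (\<gamma> - a)\<^sup>2\<close> over all zeros \<open>\<gamma> \<noteq> a\<close>. Hence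
  \<open>-P\<Xi>'(a)\<close> is at least three times that sum. Adding this for \<open>a = \<gamma>\<^sub>-\<close> and \<open>a = \<gamma>\<^sub>+\<close>, where each
  of the two sums contains the other member of the pair and thus a term \<open>1/\<Delta>\<^sup>2\<close>, yields
  \<open>3 (g + 2/\<Delta>\<^sup>2) \<le> -P\<Xi>'(\<gamma>\<^sub>+) - P\<Xi>'(\<gamma>\<^sub>-)\<close>. A strong Lehmer pair therefore satisfies
  \<open>3 \<Delta>\<^sup>2 g + 6 < 42/5\<close>, that is \<open>\<Delta>\<^sup>2 g < 4/5\<close>.

  Two facts about \<open>\<Xi>\<close> carry this. The first is Riemann's formula \<open>riemann_Xi_eq\<close>, which writes
  \<open>\<Xi>(t)\<close> as \<open>1/2 - (t\<^sup>2 + 1/4)/2\<close> times the cosine transform of a kernel that decays doubly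
  exponentially. It shows at once that \<open>\<Xi>\<close> is entire, real on the real axis and
  \<open>O(exp (3 (1 + |t|)\<^sup>3\<^sup>/\<^sup>2))\<close>. It is obtained from the Mellin transform of the theta series
  (\<open>theta_tail_Mellin\<close>) by folding the integral over the real line at the origin with the functional
  equation \<open>theta_functional_equation\<close>, i.e. Poisson summation for the Gaussian; the same formula
  supplies the analytic continuation of zeta that the definite description in its definition asks
  for.

  The second is the part of Hadamard's factorisation theorem that concerns the second derivative of
  the logarithm, \<open>has_sum_zeros_deriv_logderiv\<close>. No infinite product is needed: after division by
  the zeros in a disc of radius \<open>R\<close>, the maximum principle bounds the quotient on that disc by
  \<open>h\<close> on the circle of radius \<open>2R\<close>, and the Borel-Caratheodory inequality bounds the second
  derivative of its logarithm at the centre by \<open>O(R\<^sup>q / R\<^sup>2)\<close>, which tends to \<open>0\<close>.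
\<close>

section \<open>Poisson summation for the Gaussian\<close>

text \<open>
  The terms are \<open>n\<close>-th powers of \<open>exp (-x n) w\<close>, which tends to \<open>0\<close>. Convergence at every \<open>w\<close> makes
  Gaussian sums restrictions of entire power series, and so differentiable without further estimates.
\<close>
lemma summable_gauss_powser:
  fixes w :: real
  assumes "x > 0"
  shows "summable (\<lambda>n. exp (- x * (real n)\<^sup>2) * w ^ n)"
proof -
  have "((\<lambda>n. exp (- x * real n) * \<bar>w\<bar>) \<longlongrightarrow> 0 * \<bar>w\<bar>) sequentially"
    by (intro tendsto_mult_right) (use assms in real_asymp)
  then have "\<forall>\<^sub>F n in sequentially. exp (- x * real n) * \<bar>w\<bar> < 1/2"
    by (rule order_tendstoD) simp
  then have "\<forall>\<^sub>F n in sequentially. norm (exp (- x * (real n)\<^sup>2) * w ^ n) \<le> (1/2) ^ n"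
  proof eventually_elim
    case (elim n)
    have "norm (exp (- x * (real n)\<^sup>2) * w ^ n) = (exp (- x * real n) * \<bar>w\<bar>) ^ n"
      by (simp add: abs_mult power_abs power_mult_distrib power2_eq_square mult_ac flip: exp_of_nat_mult)
    also have "\<dots> \<le> (1/2) ^ n" using elim by (intro power_mono) auto
    finally show ?case .
  qed
  then show ?thesis
    by (rule summable_comparison_test_ev) (auto intro: summable_geometric)
qed

text \<open>
  A rescaling of the characteristic function of the standard normal distribution.
\<close>
lemma gauss_fourier:
  fixes x :: real
  assumes "x > 0"
  shows "has_bochner_integral lborel (\<lambda>t. exp (- pi * x * t\<^sup>2) * cos (2 * pi * n * t)) (exp (- pi * n\<^sup>2 / x) / sqrt x)"
proof -
  define \<sigma> where "\<sigma> = sqrt (2 * pi * x)"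
  have \<sigma>: "\<sigma> > 0" "\<sigma>\<^sup>2 = 2 * pi * x" using assms by (auto simp: \<sigma>_def)
  define s where "s = 2 * pi * n / \<sigma>"
  have int: "integrable lborel (\<lambda>u. std_normal_density u *\<^sub>R cos (s * u))"
    by (rule Bochner_Integration.integrable_bound[of _ std_normal_density])
       (auto simp: abs_mult intro!: mult_left_le)
  interpret std: prob_space std_normal_distribution
    by (rule prob_space_normal_density) simp
  have "(\<integral>u. std_normal_density u *\<^sub>R cos (s * u) \<partial>lborel) = (\<integral>u. cos (s * u) \<partial>std_normal_distribution)"
    by (subst integral_density) auto
  also have "\<dots> = (\<integral>u. Re (iexp (s * u)) \<partial>std_normal_distribution)"
    by (simp add: Re_exp)
  also have "\<dots> = Re (char std_normal_distribution s)"
    unfolding char_def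
    by (rule integral_Re) (auto intro!: std.integrable_const_bound[of _ 1])
  also have "\<dots> = exp (- s\<^sup>2 / 2)"
    by (simp add: char_std_normal_distribution)
  finally have "has_bochner_integral lborel (\<lambda>u. std_normal_density u *\<^sub>R cos (s * u)) (exp (- s\<^sup>2 / 2))"
    using int by (simp add: has_bochner_integral_iff)
  note * = lborel_has_bochner_integral_real_affine_iff[of \<sigma>, THEN iffD1, OF _ this, of 0]
  have "has_bochner_integral lborel (\<lambda>t. std_normal_density (0 + \<sigma> * t) *\<^sub>R cos (s * (0 + \<sigma> * t)))
      (exp (- s\<^sup>2 / 2) /\<^sub>R \<bar>\<sigma>\<bar>)"
    by (rule *) (use \<sigma>(1) in simp)
  moreover have "exp (- s\<^sup>2 / 2) /\<^sub>R \<bar>\<sigma>\<bar> = exp (- s\<^sup>2 / 2) / \<sigma>"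
    using \<sigma>(1) by (simp add: field_simps)
  ultimately have "has_bochner_integral lborel (\<lambda>t. std_normal_density (\<sigma> * t) * cos (s * (\<sigma> * t)))
      (exp (- s\<^sup>2 / 2) / \<sigma>)"
    by simp
  then have "has_bochner_integral lborel (\<lambda>t. sqrt (2 * pi) * (std_normal_density (\<sigma> * t) * cos (s * (\<sigma> * t))))
     (sqrt (2 * pi) * (exp (- s\<^sup>2 / 2) / \<sigma>))"
    by (rule has_bochner_integral_mult_right)
  moreover have "sqrt (2 * pi) * (std_normal_density (\<sigma> * t) * cos (s * (\<sigma> * t))) = exp (- pi * x * t\<^sup>2) * cos (2 * pi * n * t)" for t
    using \<sigma> by (simp add: std_normal_density_def s_def power_mult_distrib mult.assoc)
  moreover have "sqrt (2 * pi) * (exp (- s\<^sup>2 / 2) / \<sigma>) = exp (- pi * n\<^sup>2 / x) / sqrt x"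
  proof -
    have "s\<^sup>2 / 2 = pi * n\<^sup>2 / x" using assms \<sigma> by (simp add: s_def power_divide power_mult_distrib power2_eq_square)
    moreover have "\<sigma> = sqrt (2 * pi) * sqrt x" by (simp add: \<sigma>_def real_sqrt_mult)
    ultimately show ?thesis by simp
  qed
  ultimately show ?thesis by simp
qed

lemma has_integral_cos_int:
  fixes m :: int
  shows "((\<lambda>t. cos (2 * pi * m * t)) has_integral (if m = 0 then 1 else 0)) {-1/2..1/2}"
proof (cases "m = 0")
  case True
  then show ?thesis using has_integral_const_real[of "1::real" "-1/2" "1/2"] by simp
next
  case False
  have "((\<lambda>t. cos (2 * pi * m * t)) has_integral
          (sin (2 * pi * m * (1/2)) / (2 * pi * m) - sin (2 * pi * m * (-1/2)) / (2 * pi * m))) {-1/2..1/2}"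
    using False
    by (intro fundamental_theorem_of_calculus)
       (auto simp: has_real_derivative_iff_has_vector_derivative[symmetric] intro!: derivative_eq_intros)
  moreover have "sin (2 * pi * m * (1/2)) = 0" "sin (2 * pi * m * (-1/2)) = 0"
    using sin_int_2pin[of m] by (simp_all add: sin_zero_iff_int2 mult.commute)
  ultimately show ?thesis using False by simp
qed

lemma dirichlet_kernel:
  "sin (pi * t) * (1 + 2 * (\<Sum>n=1..N. cos (2 * pi * real n * t))) = sin (real (2 * N + 1) * pi * t)"
proof (induction N)
  case (Suc N)
  define a b where "a = 2 * pi * real (Suc N) * t" and "b = pi * t"
  have "sin (a + b) - sin (a - b) = 2 * sin b * cos a" by (simp add: sin_add sin_diff)
  moreover have "a + b = real (2 * Suc N + 1) * pi * t" "a - b = real (2 * N + 1) * pi * t"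
    by (simp_all add: a_def b_def algebra_simps)
  ultimately have "sin (real (2 * Suc N + 1) * pi * t) - sin (real (2 * N + 1) * pi * t)
     = 2 * sin (pi * t) * cos (2 * pi * real (Suc N) * t)"
    by (simp only: a_def b_def)
  then show ?case using Suc.IH by (simp add: algebra_simps)
qed simp

lemma odd_sine_orthogonal:
  "((\<lambda>t. sin (real (2 * i + 1) * pi * t) * sin (real (2 * j + 1) * pi * t))
      has_integral (if i = j then 1/2 else 0)) {-1/2..1/2}"
proof -
  have *: "((\<lambda>t. (cos (2 * pi * real_of_int (int i - int j) * t) - cos (2 * pi * real_of_int (int i + int j + 1) * t)) / 2)
      has_integral (((if int i - int j = 0 then 1 else 0) - (if int i + int j + 1 = 0 then 1 else 0)) / 2)) {-1/2..1/2}"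
    by (intro has_integral_divide has_integral_diff has_integral_cos_int)
  have eq: "(cos (2 * pi * real_of_int (int i - int j) * t) - cos (2 * pi * real_of_int (int i + int j + 1) * t)) / 2 =
    sin (real (2 * i + 1) * pi * t) * sin (real (2 * j + 1) * pi * t)" for t
    unfolding sin_times_sin by (simp add: algebra_simps)
  show ?thesis using * unfolding eq by (auto split: if_splits)
qed

text \<open>
  The odd sines are orthogonal with square norm \<open>1/2\<close> on this interval, so by Bessel's inequality
  the squares of the coefficients are summable.
\<close>
lemma riemann_lebesgue_odd_sine:
  fixes H :: "real \<Rightarrow> real"
  assumes H: "continuous_on {-1/2..1/2} H"
  shows "(\<lambda>N. integral {-1/2..1/2} (\<lambda>t. H t * sin (real (2 * N + 1) * pi * t))) \<longlonglongrightarrow> 0"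
proof -
  let ?I = "integral {-1/2..1/2::real}"
  define \<phi> where "\<phi> = (\<lambda>N t. sin (real (2 * N + 1) * pi * t))"
  define a where "a = (\<lambda>N. ?I (\<lambda>t. H t * \<phi> N t))"
  have cont\<phi> [continuous_intros]: "continuous_on {-1/2..1/2} (\<phi> N)" for N
    unfolding \<phi>_def by (intro continuous_intros)
  have int: "f integrable_on {-1/2..1/2}" if "continuous_on {-1/2..1/2} f" for f :: "real \<Rightarrow> real"
    using that by (rule integrable_continuous_real)
  have orth: "?I (\<lambda>t. \<phi> i t * \<phi> j t) = (if i = j then 1/2 else 0)" for i j
    using odd_sine_orthogonal[of i j] by (simp add: \<phi>_def integral_unique)
  have bessel: "(\<Sum>k<N. (a k)\<^sup>2) \<le> ?I (\<lambda>t. (H t)\<^sup>2) / 2" for N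
  proof -
    define p where "p = (\<lambda>t. \<Sum>k<N. a k * \<phi> k t)"
    have contp [continuous_intros]: "continuous_on {-1/2..1/2} p" unfolding p_def by (intro continuous_intros)
    have Hp: "?I (\<lambda>t. H t * p t) = (\<Sum>k<N. (a k)\<^sup>2)"
    proof -
      have "?I (\<lambda>t. H t * p t) = ?I (\<lambda>t. \<Sum>k<N. a k * (H t * \<phi> k t))"
        by (simp add: p_def sum_distrib_left mult_ac)
      also have "\<dots> = (\<Sum>k<N. ?I (\<lambda>t. a k * (H t * \<phi> k t)))"
        by (intro integral_sum int continuous_intros H) auto
      finally show ?thesis by (simp add: a_def power2_eq_square)
    qed
    have pp: "?I (\<lambda>t. p t * p t) = (\<Sum>k<N. (a k)\<^sup>2) / 2"
    proof -
      have "?I (\<lambda>t. p t * p t) = ?I (\<lambda>t. \<Sum>k<N. \<Sum>j<N. a k * (a j * (\<phi> k t * \<phi> j t)))"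
        by (simp add: p_def sum_product mult_ac)
      also have "\<dots> = (\<Sum>k<N. \<Sum>j<N. ?I (\<lambda>t. a k * (a j * (\<phi> k t * \<phi> j t))))"
        by (subst integral_sum | intro int continuous_intros sum.cong refl finite_lessThan)+
      also have "\<dots> = (\<Sum>k<N. \<Sum>j<N. if k = j then (a k)\<^sup>2 / 2 else 0)"
      proof (intro sum.cong refl)
        show "?I (\<lambda>t. a k * (a j * (\<phi> k t * \<phi> j t))) = (if k = j then (a k)\<^sup>2 / 2 else 0)" for k j
          using orth[of k j] by (auto simp: power2_eq_square)
      qed
      finally show ?thesis by (simp add: sum_divide_distrib)
    qed
    \<comment> \<open>Twice \<open>p\<close> is the orthogonal projection of \<open>H\<close>, because the square norms are \<open>1/2\<close>.\<close>
    have "0 \<le> ?I (\<lambda>t. (H t - 2 * p t)\<^sup>2)"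
      by (intro integral_nonneg int continuous_intros H) auto
    also have "\<dots> = ?I (\<lambda>t. (H t)\<^sup>2 - 4 * (H t * p t) + 4 * (p t * p t))"
      by (simp add: power2_eq_square algebra_simps)
    also have "\<dots> = ?I (\<lambda>t. (H t)\<^sup>2) - 4 * ?I (\<lambda>t. H t * p t) + 4 * ?I (\<lambda>t. p t * p t)"
      by (intro integral_unique has_integral_add has_integral_diff has_integral_mult_right
            integrable_integral int continuous_intros H)
    finally show ?thesis unfolding Hp pp by simp
  qed
  have "summable (\<lambda>k. (a k)\<^sup>2)"
    by (rule summableI_nonneg_bounded[OF _ bessel]) simp
  then have "(\<lambda>k. (a k)\<^sup>2) \<longlonglongrightarrow> 0" by (rule summable_LIMSEQ_zero)
  then have "a \<longlonglongrightarrow> 0" by (simp add: power_tendsto_0_iff)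
  then show ?thesis by (simp add: a_def \<phi>_def)
qed

text \<open>
  Pointwise Fourier inversion in Chernoff's form: by the formula for the Dirichlet kernel, the partial
  sum minus \<open>F 0\<close> is the integral of \<open>(F t - F 0) / sin (\<pi> t)\<close> against an odd sine of high frequency.
  Differentiability at \<open>0\<close> makes that quotient continuous, so the integral vanishes in the limit.
\<close>
lemma cosine_series_at_0:
  fixes F :: "real \<Rightarrow> real"
  assumes F: "continuous_on {-1/2..1/2} F" and D: "(F has_real_derivative D) (at 0)"
  shows "(\<lambda>N. integral {-1/2..1/2} F + 2 * (\<Sum>n=1..N. integral {-1/2..1/2} (\<lambda>t. F t * cos (2 * pi * real n * t))))
           \<longlonglongrightarrow> F 0"
proof -
  let ?I = "integral {-1/2..1/2::real}"
  define H where "H = (\<lambda>t. if t = 0 then D / pi else (F t - F 0) / sin (pi * t))"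
  have sin_nz: "sin (pi * t) \<noteq> 0" if "t \<in> {-1/2..1/2}" "t \<noteq> 0" for t :: real
  proof (cases "t > 0")
    case True
    then have "sin (pi * t) > 0"
      using that mult_strict_left_mono[of t 1 pi] by (intro sin_gt_zero) auto
    then show ?thesis by simp
  next
    case False
    then have "sin (pi * (- t)) > 0"
      using that mult_strict_left_mono[of "- t" 1 pi] by (intro sin_gt_zero mult_pos_pos) auto
    then show ?thesis by simp
  qed
  have H: "continuous_on {-1/2..1/2} H"
    unfolding continuous_on_def
  proof
    fix t :: real assume t: "t \<in> {-1/2..1/2}"
    show "(H \<longlongrightarrow> H t) (at t within {- 1 / 2..1 / 2})"
    proof (cases "t = 0")
      case False
      have "((\<lambda>t. (F t - F 0) / sin (pi * t)) \<longlongrightarrow> (F t - F 0) / sin (pi * t)) (at t within {-1/2..1/2})"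
        using F t sin_nz[OF t False] by (intro tendsto_intros) (auto simp: continuous_on_def)
      moreover have "\<forall>\<^sub>F s in at t within {-1/2..1/2}. (F s - F 0) / sin (pi * s) = H s"
        unfolding eventually_at_filter using t1_space_nhds[OF False]
        by eventually_elim (auto simp: H_def)
      ultimately have "(H \<longlongrightarrow> (F t - F 0) / sin (pi * t)) (at t within {-1/2..1/2})"
        by (rule Lim_transform_eventually)
      then show ?thesis using False by (simp add: H_def)
    next
      case True
      have "((\<lambda>s. ((F s - F 0) / s) * (s / sin (pi * s))) \<longlongrightarrow> D * inverse pi) (at 0)"
      proof (intro tendsto_mult)
        show "((\<lambda>s. (F s - F 0) / s) \<longlongrightarrow> D) (at 0)" using D by (simp add: has_field_derivative_iff)
        show "((\<lambda>s. s / sin (pi * s)) \<longlongrightarrow> inverse pi) (at 0)" by real_asymp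
      qed
      moreover have "\<forall>\<^sub>F s in at 0. ((F s - F 0) / s) * (s / sin (pi * s)) = H s"
        by (auto simp: H_def eventually_at_filter)
      ultimately have "(H \<longlongrightarrow> D * inverse pi) (at 0)" by (rule Lim_transform_eventually)
      then have "(H \<longlongrightarrow> D * inverse pi) (at 0 within {-1/2..1/2})"
        by (rule tendsto_within_subset) simp
      moreover have "H t = D * inverse pi" using True by (simp add: H_def field_simps)
      ultimately show ?thesis using True by simp
    qed
  qed
  have "?I (\<lambda>t. H t * sin (real (2 * N + 1) * pi * t)) =
     ?I F + 2 * (\<Sum>n=1..N. ?I (\<lambda>t. F t * cos (2 * pi * real n * t))) - F 0" for N
  proof -
    have "H t * sin (real (2 * N + 1) * pi * t) = 
       (F t + 2 * (\<Sum>n=1..N. F t * cos (2 * pi * real n * t))) - F 0 * (1 + 2 * (\<Sum>n=1..N. cos (2 * pi * real n * t)))"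
      if "t \<in> {-1/2..1/2}" for t
    proof -
      have "H t * sin (real (2 * N + 1) * pi * t) = (F t - F 0) * (1 + 2 * (\<Sum>n=1..N. cos (2 * pi * real n * t)))"
        unfolding dirichlet_kernel[symmetric] using sin_nz[OF that] by (auto simp: H_def)
      also have "\<dots> = (F t + 2 * (F t * (\<Sum>n=1..N. cos (2 * pi * real n * t)))) - F 0 * (1 + 2 * (\<Sum>n=1..N. cos (2 * pi * real n * t)))"
        by (simp only: algebra_simps)
      finally show ?thesis by (simp only: sum_distrib_left)
    qed
    then have "?I (\<lambda>t. H t * sin (real (2 * N + 1) * pi * t)) =
       ?I (\<lambda>t. (F t + 2 * (\<Sum>n=1..N. F t * cos (2 * pi * real n * t))) - F 0 * (1 + 2 * (\<Sum>n=1..N. cos (2 * pi * real n * t))))"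
      by (intro integral_cong)
    also have "\<dots> = ?I F + 2 * (\<Sum>n=1..N. ?I (\<lambda>t. F t * cos (2 * pi * real n * t))) - F 0 * (1 + 2 * (\<Sum>n=1..N. (0::real)))"
    proof (intro integral_unique has_integral_diff has_integral_add has_integral_mult_right has_integral_sum)
      show "(F has_integral ?I F) {-1/2..1/2}" using F by (intro integrable_integral integrable_continuous_real)
      show "((\<lambda>t. F t * cos (2 * pi * real n * t)) has_integral ?I (\<lambda>t. F t * cos (2 * pi * real n * t))) {-1/2..1/2}" for n
        using F by (intro integrable_integral integrable_continuous_real continuous_intros)
      show "((\<lambda>t. 1) has_integral (1::real)) {-1/2..1/2::real}" using has_integral_cos_int[of 0] by simp
      show "((\<lambda>t. cos (2 * pi * real n * t)) has_integral 0) {-1/2..1/2}" if "n \<in> {1..N}" for n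
        using has_integral_cos_int[of "int n"] that by simp
    qed auto
    finally show ?thesis by simp
  qed
  with riemann_lebesgue_odd_sine[OF H]
  have "(\<lambda>N. ?I F + 2 * (\<Sum>n=1..N. ?I (\<lambda>t. F t * cos (2 * pi * real n * t))) - F 0) \<longlonglongrightarrow> 0" by simp
  then show ?thesis by (simp add: LIM_zero_iff)
qed


text \<open>
  At \<open>w = 1\<close> this is one half of the theta series, except that the term at \<open>n = 0\<close> counts in full. The variable
  \<open>w\<close> is there to reach the translates of the Gaussian.
\<close>
definition gauss_series :: "real \<Rightarrow> real \<Rightarrow> real" where
  "gauss_series x w = (\<Sum>n. exp (- x * (real n)\<^sup>2) * w ^ n)"

text \<open>
  Completing the square, \<open>g (t + k) = g t * g k * exp (-2 x t k)\<close>; the positive and the negative \<open>k\<close> each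
  give a value of the same power series, and both contain \<open>k = 0\<close>.
\<close>
lemma periodised_gaussian_sums:
  fixes x t :: real
  assumes x: "x > 0"
  defines "g \<equiv> (\<lambda>t::real. exp (- x * t\<^sup>2))"
  shows "(\<lambda>K. \<Sum>k\<in>{-int K..int K}. g (t + real_of_int k))
           \<longlonglongrightarrow> g t * (gauss_series x (exp (- 2 * x * t)) + gauss_series x (exp (2 * x * t)) - 1)"
proof -
  define c where "c = (\<lambda>n. exp (- x * (real n)\<^sup>2))"
  have split: "g (t + real_of_int k) = g t * (c (nat \<bar>k\<bar>) * exp (- 2 * x * t * k))" for k :: int
  proof -
    have "(t + real_of_int k)\<^sup>2 = t\<^sup>2 + (real (nat \<bar>k\<bar>))\<^sup>2 + 2 * t * k"
      by (simp add: power2_eq_square algebra_simps)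
    then show ?thesis by (simp add: g_def c_def algebra_simps flip: exp_add)
  qed
  have split_nat: "g (t + real_of_int (int n)) = g t * (c n * exp (- 2 * x * t) ^ n)"
    "g (t + real_of_int (- int n)) = g t * (c n * exp (2 * x * t) ^ n)" for n
    using split[of "int n"] split[of "- int n"] by (simp_all add: mult_ac flip: exp_of_nat_mult)
  have partial: "(\<Sum>k\<in>{-int K..int K}. g (t + real_of_int k)) =
     g t * ((\<Sum>n\<le>K. c n * exp (- 2 * x * t) ^ n) + (\<Sum>n\<le>K. c n * exp (2 * x * t) ^ n) - 1)" for K
  proof (induction K)
    case 0
    show ?case by (simp add: c_def)
  next
    case (Suc K)
    have "{-int (Suc K)..int (Suc K)} = insert (int (Suc K)) (insert (- int (Suc K)) {-int K..int K})"
      by auto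
    then have "(\<Sum>k\<in>{-int (Suc K)..int (Suc K)}. g (t + real_of_int k)) =
      g (t + real_of_int (int (Suc K))) + (g (t + real_of_int (- int (Suc K))) + (\<Sum>k\<in>{-int K..int K}. g (t + real_of_int k)))"
      by simp
    also have "g (t + real_of_int (int (Suc K))) = g t * (c (Suc K) * exp (- 2 * x * t) ^ Suc K)"
      by (rule split_nat)
    also have "g (t + real_of_int (- int (Suc K))) = g t * (c (Suc K) * exp (2 * x * t) ^ Suc K)"
      by (rule split_nat)
    finally show ?case using Suc.IH by (simp add: algebra_simps)
  qed
  have lim: "(\<lambda>K. \<Sum>n\<le>K. c n * w ^ n) \<longlonglongrightarrow> gauss_series x w" for w
    using summable_LIMSEQ'[OF summable_gauss_powser[OF x, of w]] by (simp add: c_def gauss_series_def)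
  show ?thesis unfolding partial by (intro tendsto_intros lim)
qed

lemma gauss_series_has_derivative:
  assumes "x > 0"
  obtains D where "\<And>w. (gauss_series x has_real_derivative D w) (at w)"
proof -
  have "(gauss_series x has_real_derivative (\<Sum>n. diffs (\<lambda>n. exp (- x * (real n)\<^sup>2)) n * w ^ n)) (at w)" for w
    unfolding gauss_series_def
    by (rule termdiffs_strong_converges_everywhere) (rule summable_gauss_powser[OF assms])
  then show thesis by (rule that[of "\<lambda>w. \<Sum>n. diffs (\<lambda>n. exp (- x * (real n)\<^sup>2)) n * w ^ n"])
qed

text \<open>
  The translates of the unit interval centred at \<open>0\<close> tile a long interval.
\<close>
lemma integral_unfold_periodisation:
  fixes g :: "real \<Rightarrow> real"
  assumes cont: "continuous_on UNIV g"
  shows "integral {-1/2..1/2} (\<lambda>t. \<Sum>k\<in>{-int K..int K}. g (t + real_of_int k)) = integral {-real K - 1/2..real K + 1/2} g"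
proof (induction K)
  case (Suc K)
  have cont': "continuous_on A g" for A using cont by (rule continuous_on_subset) simp
  have int: "g integrable_on {a..b}" for a b by (intro integrable_continuous_real cont')
  have shift: "integral {-1/2..1/2} (\<lambda>t. g (t + c)) = integral {c - 1/2..c + 1/2} g" for c
    using integral_shift_Icc_real[of "-1/2" "1/2" g c] by (simp add: o_def add.commute)
  have "{-int (Suc K)..int (Suc K)} = insert (int (Suc K)) (insert (- int (Suc K)) {-int K..int K})"
    by auto
  then have "integral {-1/2..1/2} (\<lambda>t. \<Sum>k\<in>{-int (Suc K)..int (Suc K)}. g (t + real_of_int k))
     = integral {-1/2..1/2} (\<lambda>t. g (t + real (Suc K)) + (g (t + - real (Suc K)) + (\<Sum>k\<in>{-int K..int K}. g (t + real_of_int k))))"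
    by simp
  also have "\<dots> = integral {-1/2..1/2} (\<lambda>t. g (t + real (Suc K))) + (integral {-1/2..1/2} (\<lambda>t. g (t + - real (Suc K)))
      + integral {-1/2..1/2} (\<lambda>t. \<Sum>k\<in>{-int K..int K}. g (t + real_of_int k)))"
    by (intro integral_unique has_integral_add integrable_integral integrable_continuous_real
          continuous_intros continuous_on_compose2[OF cont]) auto
  also have "\<dots> = integral {real (Suc K) - 1/2..real (Suc K) + 1/2} g + (integral {- real (Suc K) - 1/2..- real (Suc K) + 1/2} g
      + integral {-real K - 1/2..real K + 1/2} g)"
    by (simp only: shift Suc.IH)
  also have "integral {- real (Suc K) - 1/2..- real (Suc K) + 1/2} g + integral {-real K - 1/2..real K + 1/2} g
     = integral {- real (Suc K) - 1/2..real K + 1/2} g"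
  proof -
    have eq: "- real (Suc K) + 1/2 = - real K - 1/2" by simp
    show ?thesis
      unfolding eq by (rule Henstock_Kurzweil_Integration.integral_combine[OF _ _ int]) auto
  qed
  also have "integral {real (Suc K) - 1/2..real (Suc K) + 1/2} g + \<dots> = integral {- real (Suc K) - 1/2..real (Suc K) + 1/2} g"
  proof -
    have eq: "real (Suc K) - 1/2 = real K + 1/2" by simp
    show ?thesis
      unfolding eq
      by (subst add.commute, rule Henstock_Kurzweil_Integration.integral_combine[OF _ _ int]) auto
  qed
  finally show ?case .
qed simp

lemma integral_growing_intervals:
  fixes f :: "real \<Rightarrow> real"
  assumes "has_bochner_integral lborel f I"
  shows "(\<lambda>K. integral {-real K - 1/2..real K + 1/2} f) \<longlonglongrightarrow> I"
proof -
  let ?A = "\<lambda>K. {-real K - 1/2..real K + 1/2}"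
  have int: "integrable lborel f" "integral\<^sup>L lborel f = I" using assms by (auto simp: has_bochner_integral_iff)
  have "(\<Union>K. ?A K) = UNIV"
  proof -
    have "y \<in> ?A (nat \<lceil>\<bar>y\<bar>\<rceil>)" for y by (auto; linarith)
    then show ?thesis by blast
  qed
  moreover have "(\<lambda>K. set_lebesgue_integral lborel (?A K) f) \<longlonglongrightarrow> set_lebesgue_integral lborel (\<Union>K. ?A K) f"
    by (rule set_integral_cont_up)
       (use int(1) calculation in \<open>auto simp: incseq_def set_integrable_def\<close>)
  moreover have "set_lebesgue_integral lborel (?A K) f = integral (?A K) f" for K
    by (rule set_borel_integral_eq_integral)
       (use int(1) in \<open>auto simp: set_integrable_def intro!: integrable_mult_indicator[of _ lborel f, simplified]\<close>)
  ultimately show ?thesis using int(2) by (simp add: set_lebesgue_integral_def)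
qed

text \<open>
  Jacobi's identity. The periodised Gaussian \<open>F\<close> has value \<open>\<theta>(x)\<close> at \<open>0\<close>. Its Fourier coefficients are
  those of the Gaussian on the whole line, by unfolding, and hence again Gaussian values, so their sum
  is \<open>\<theta>(1/x)\<close> up to the factor \<open>1 / \<surd>x\<close>.
\<close>
lemma theta_functional_equation:
  assumes x: "x > 0"
  shows "2 * gauss_series (pi * x) 1 - 1 = (2 * gauss_series (pi / x) 1 - 1) / sqrt x"
proof -
  have x': "pi * x > 0" "pi / x > 0" using x by auto
  define P where "P = gauss_series (pi * x)"
  obtain P' where P': "\<And>w. (P has_real_derivative P' w) (at w)"
    unfolding P_def by (rule gauss_series_has_derivative[OF x'(1)]) blast
  define g where "g = (\<lambda>t::real. exp (- pi * x * t\<^sup>2))"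
  define F where "F = (\<lambda>t. g t * (P (exp (- 2 * (pi * x) * t)) + P (exp (2 * (pi * x) * t)) - 1))"
  define S where "S = (\<lambda>K t. \<Sum>k\<in>{-int K..int K}. g (t + real_of_int k))"
  have S_lim: "(\<lambda>K. S K t) \<longlonglongrightarrow> F t" for t
    using periodised_gaussian_sums[OF x'(1), of t] by (simp add: S_def F_def P_def g_def mult_ac)
  have S_le: "0 \<le> S K t" "S K t \<le> F t" for K t
  proof -
    show "0 \<le> S K t" by (auto simp: S_def g_def intro: sum_nonneg)
    have "incseq (\<lambda>K. S K t)"
      unfolding S_def by (intro incseq_SucI sum_mono2) (auto simp: g_def)
    then show "S K t \<le> F t" using S_lim[of t] by (rule incseq_le)
  qed
  have "\<exists>D. (F has_real_derivative D) (at t)" for t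
    unfolding F_def g_def
    by (rule exI) (rule derivative_eq_intros DERIV_chain2[of P, OF P'] refl)+
  then have F_cont: "continuous_on A F" and D: "\<exists>D. (F has_real_derivative D) (at 0)" for A
    by (meson DERIV_isCont continuous_at_imp_continuous_on, blast)
  obtain D where D: "(F has_real_derivative D) (at 0)" using D by blast
  have coeff: "integral {-1/2..1/2} (\<lambda>t. F t * cos (2 * pi * real n * t)) = exp (- pi * (real n)\<^sup>2 / x) / sqrt x" for n
  proof -
    let ?C = "\<lambda>t. cos (2 * pi * real n * t)"
    have "(\<lambda>K. integral {-1/2..1/2} (\<lambda>t. S K t * ?C t)) \<longlonglongrightarrow> integral {-1/2..1/2} (\<lambda>t. F t * ?C t)"
    proof (rule dominated_convergence(2))
      show "F integrable_on {-1/2..1/2}" by (intro integrable_continuous_real F_cont)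
      show "(\<lambda>t. S K t * ?C t) integrable_on {-1/2..1/2}" for K
        unfolding S_def g_def by (intro integrable_continuous_real continuous_intros)
      show "norm (S K t * ?C t) \<le> F t" for K t
      proof -
        have "\<bar>S K t * ?C t\<bar> \<le> S K t * 1"
          unfolding abs_mult using S_le(1)[of K t] by (intro mult_mono) auto
        then show ?thesis using S_le(2)[of K t] by simp
      qed
      show "(\<lambda>K. S K t * ?C t) \<longlonglongrightarrow> F t * ?C t" for t by (intro tendsto_intros S_lim)
    qed
    moreover have "integral {-1/2..1/2} (\<lambda>t. S K t * ?C t) = integral {-real K - 1/2..real K + 1/2} (\<lambda>t. g t * ?C t)" for K
    proof -
      have "?C (t + real_of_int k) = ?C t" for t k
      proof -
        have "2 * pi * real n * (t + real_of_int k) = 2 * pi * real n * t + 2 * pi * real_of_int (int n * k)"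
          by (simp add: algebra_simps)
        then show ?thesis using cos_int_2pin[of "int n * k"] sin_int_2pin[of "int n * k"]
          by (simp add: cos_add)
      qed
      then have eq: "S K t * ?C t = (\<Sum>k\<in>{-int K..int K}. g (t + real_of_int k) * ?C (t + real_of_int k))" for t
        by (simp add: S_def sum_distrib_right)
      have "continuous_on UNIV (\<lambda>t. g t * ?C t)" unfolding g_def by (intro continuous_intros)
      then show ?thesis unfolding eq by (rule integral_unfold_periodisation)
    qed
    ultimately have "(\<lambda>K. integral {-real K - 1/2..real K + 1/2} (\<lambda>t. g t * ?C t)) \<longlonglongrightarrow> integral {-1/2..1/2} (\<lambda>t. F t * ?C t)"
      by simp
    moreover have "(\<lambda>K. integral {-real K - 1/2..real K + 1/2} (\<lambda>t. g t * ?C t)) \<longlonglongrightarrow> exp (- pi * (real n)\<^sup>2 / x) / sqrt x"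
      unfolding g_def by (rule integral_growing_intervals[OF gauss_fourier[OF x]])
    ultimately show ?thesis by (rule LIMSEQ_unique)
  qed
  define c where "c = (\<lambda>n. exp (- (pi / x) * (real n)\<^sup>2))"
  have "(\<lambda>N. integral {-1/2..1/2} F + 2 * (\<Sum>n=1..N. c n / sqrt x)) \<longlonglongrightarrow> F 0"
    using cosine_series_at_0[OF F_cont D] unfolding coeff by (simp add: c_def)
  moreover have "integral {-1/2..1/2} F = 1 / sqrt x"
    using coeff[of 0] by simp
  moreover have "1 / sqrt x + 2 * (\<Sum>n=1..N. c n / sqrt x) = (2 * (\<Sum>n\<le>N. c n) - 1) / sqrt x" for N
  proof -
    have "(\<Sum>n\<le>N. c n) = 1 + (\<Sum>n=1..N. c n)"
      by (induction N) (simp_all add: c_def)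
    then show ?thesis by (simp add: add_divide_distrib flip: sum_divide_distrib)
  qed
  ultimately have "(\<lambda>N. (2 * (\<Sum>n\<le>N. c n) - 1) / sqrt x) \<longlonglongrightarrow> F 0" by simp
  moreover have "(\<lambda>N. (2 * (\<Sum>n\<le>N. c n) - 1) / sqrt x) \<longlonglongrightarrow> (2 * gauss_series (pi / x) 1 - 1) / sqrt x"
    using summable_LIMSEQ'[OF summable_gauss_powser[OF x'(2), of 1]] x
    by (intro tendsto_intros) (auto simp: c_def gauss_series_def)
  ultimately have "F 0 = (2 * gauss_series (pi / x) 1 - 1) / sqrt x" by (rule LIMSEQ_unique)
  then show ?thesis by (simp add: F_def P_def g_def)
qed

section \<open>Cosine transforms of rapidly decaying kernels\<close>

definition cos_transform :: "(real \<Rightarrow> real) \<Rightarrow> complex \<Rightarrow> complex" where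
  "cos_transform \<phi> z = (LINT u:{0..}|lborel. of_real (\<phi> u) * cos (of_real u * z))"

text \<open>
  Compare \<open>u\<close> with \<open>\<surd>r\<close>. This trades growth in \<open>u\<close>, which the kernel absorbs, for growth of order
  \<open>3/2 < 2\<close> in \<open>r\<close>.
\<close>
lemma young_three_halves:
  fixes u r :: real
  assumes "u \<ge> 0" "r \<ge> 0"
  shows "u * r \<le> u ^ 3 + r powr (3/2)"
proof (cases "r \<le> u\<^sup>2")
  case True
  then have "u * r \<le> u * u\<^sup>2" using assms by (intro mult_left_mono)
  then show ?thesis by (simp add: power3_eq_cube power2_eq_square add_increasing2)
next
  case False
  then have "u \<le> sqrt r" by (simp add: real_le_rsqrt)
  then have "u * r \<le> r powr (1/2) * r" using assms by (intro mult_right_mono) (auto simp: powr_half_sqrt)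
  also have "\<dots> = r powr (3/2)" using assms powr_mult_base[of r "1/2"] by (simp add: mult.commute)
  finally show ?thesis using assms by (simp add: add_increasing)
qed

lemma norm_cos_le_exp: "norm (cos z :: complex) \<le> exp (norm z)"
proof -
  have "norm (exp (\<i> * z) + exp (- (\<i> * z))) \<le> norm (exp (\<i> * z)) + norm (exp (- (\<i> * z)))"
    by (rule norm_triangle_ineq)
  also have "\<dots> \<le> exp (norm z) + exp (norm z)"
    using abs_Im_le_cmod[of z] by (intro add_mono) auto
  finally have "norm (exp (\<i> * z) + exp (- (\<i> * z))) \<le> exp (norm z) + exp (norm z)" .
  then show ?thesis by (simp add: cos_exp_eq norm_divide)
qed

text \<open>
  Integrability against \<open>exp (u ^ 3)\<close> makes the cosine transform an entire function of order at most
  \<open>3/2\<close>. An exponent \<open>p\<close> gives order \<open>p / (p - 1)\<close>, and \<open>3\<close> is the least integer for which this is below \<open>2\<close>.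
\<close>
locale cubic_exp_integrable =
  fixes \<phi> :: "real \<Rightarrow> real"
  assumes meas: "set_borel_measurable lborel {0..} \<phi>"
    and nonneg: "\<And>u. u \<ge> 0 \<Longrightarrow> \<phi> u \<ge> 0"
    and integrable: "set_integrable lborel {0..} (\<lambda>u. \<phi> u * exp (u ^ 3))"
begin

lemma measurable_restrict [measurable]: "(\<lambda>u. indicator {0..} u * \<phi> u) \<in> borel_measurable lborel"
  using meas by (simp add: set_borel_measurable_def)

lemma integrable_exp: "integrable lborel (\<lambda>u. indicator {0..} u * \<phi> u * exp (u * r))" if "r \<ge> 0" for r
proof (rule Bochner_Integration.integrable_bound)
  show "integrable lborel (\<lambda>u. exp (r powr (3/2)) * (indicator {0..} u * (\<phi> u * exp (u ^ 3))))"
    using integrable by (simp add: set_integrable_def)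
  show "AE u in lborel. norm (indicator {0..} u * \<phi> u * exp (u * r))
          \<le> norm (exp (r powr (3/2)) * (indicator {0..} u * (\<phi> u * exp (u ^ 3))))"
  proof (intro AE_I2)
    fix u :: real
    show "norm (indicator {0..} u * \<phi> u * exp (u * r))
          \<le> norm (exp (r powr (3/2)) * (indicator {0..} u * (\<phi> u * exp (u ^ 3))))"
    proof (cases "u \<ge> 0")
      case True
      have "\<phi> u * exp (u * r) \<le> \<phi> u * exp (r powr (3/2) + u ^ 3)"
        using young_three_halves[OF True that] nonneg[OF True] by (intro mult_left_mono) auto
      then show ?thesis using True nonneg[OF True] by (simp add: exp_add abs_mult mult_ac)
    qed simp
  qed
qed measurable

lemma integrable_cos: "integrable lborel (\<lambda>u. indicator {0..} u *\<^sub>R (complex_of_real (\<phi> u) * cos (complex_of_real u * z)))"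
proof -
  have "integrable lborel (\<lambda>u. complex_of_real (indicator {0..} u * \<phi> u) * cos (complex_of_real u * z))"
  proof (rule Bochner_Integration.integrable_bound[OF integrable_exp[of "norm z"]])
    show "AE u in lborel. norm (complex_of_real (indicator {0..} u * \<phi> u) * cos (complex_of_real u * z))
       \<le> norm (indicator {0..} u * \<phi> u * exp (u * cmod z))"
    proof (intro AE_I2)
      fix u :: real
      show "norm (complex_of_real (indicator {0..} u * \<phi> u) * cos (complex_of_real u * z))
         \<le> norm (indicator {0..} u * \<phi> u * exp (u * cmod z))"
        using norm_cos_le_exp[of "complex_of_real u * z"]
        by (cases "u \<ge> 0") (auto simp: norm_mult abs_mult intro!: mult_left_mono)
    qed
    have [measurable]: "(\<lambda>u. cos (complex_of_real u * z)) \<in> borel_measurable lborel"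
      unfolding measurable_lborel2 by (intro borel_measurable_continuous_onI continuous_intros)
    show "(\<lambda>u. complex_of_real (indicator {0..} u * \<phi> u) * cos (complex_of_real u * z)) \<in> borel_measurable lborel"
      by measurable
  qed simp
  then show ?thesis by (simp add: scaleR_conv_of_real mult.assoc)
qed

lemma cos_transform_bound:
  "norm (cos_transform \<phi> z) \<le> (LINT u:{0..}|lborel. \<phi> u * exp (u ^ 3)) * exp (norm z powr (3/2))"
proof -
  have "norm (cos_transform \<phi> z) \<le> (\<integral>u. norm (indicator {0..} u *\<^sub>R (complex_of_real (\<phi> u) * cos (complex_of_real u * z))) \<partial>lborel)"
    unfolding cos_transform_def set_lebesgue_integral_def by (rule integral_norm_bound)
  also have "\<dots> \<le> (\<integral>u. exp (norm z powr (3/2)) * (indicator {0..} u * (\<phi> u * exp (u ^ 3))) \<partial>lborel)"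
  proof (rule integral_mono)
    fix u :: real
    show "norm (indicator {0..} u *\<^sub>R (complex_of_real (\<phi> u) * cos (complex_of_real u * z)))
          \<le> exp (norm z powr (3/2)) * (indicator {0..} u * (\<phi> u * exp (u ^ 3)))"
    proof (cases "u \<ge> 0")
      case True
      have "norm (cos (complex_of_real u * z)) \<le> exp (u * norm z)"
        using norm_cos_le_exp[of "complex_of_real u * z"] True by (simp add: norm_mult)
      also have "\<dots> \<le> exp (u ^ 3 + norm z powr (3/2))" using young_three_halves[OF True, of "norm z"] by simp
      finally have "\<phi> u * norm (cos (complex_of_real u * z)) \<le> \<phi> u * exp (u ^ 3 + norm z powr (3/2))"
        using nonneg[OF True] by (intro mult_left_mono)
      then show ?thesis using True nonneg[OF True] by (simp add: norm_mult exp_add mult_ac)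
    qed simp
  next
    show "integrable lborel (\<lambda>u. norm (indicator {0..} u *\<^sub>R (complex_of_real (\<phi> u) * cos (complex_of_real u * z))))"
      by (intro integrable_norm integrable_cos)
    show "integrable lborel (\<lambda>u. exp (norm z powr (3/2)) * (indicator {0..} u * (\<phi> u * exp (u ^ 3))))"
      using integrable by (simp add: set_integrable_def)
  qed
  also have "\<dots> = (LINT u:{0..}|lborel. \<phi> u * exp (u ^ 3)) * exp (norm z powr (3/2))"
    by (simp add: set_lebesgue_integral_def mult.commute)
  finally show ?thesis .
qed

text \<open>
  Integrating the cosine series term by term, which is justified by dominated convergence, exhibits
  the transform as an everywhere convergent power series.
\<close>
lemma cos_transform_holomorphic: "cos_transform \<phi> holomorphic_on UNIV"
proof -
  define a where "a = (\<lambda>n. complex_of_real (cos_coeff n * (\<integral>u. indicator {0..} u * \<phi> u * u ^ n \<partial>lborel)))"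
  have int_pow: "integrable lborel (\<lambda>u. indicator {0..} u * \<phi> u * u ^ n)" for n
  proof (rule Bochner_Integration.integrable_bound)
    show "integrable lborel (\<lambda>u. fact n * (indicator {0..} u * \<phi> u * exp (u * 1)))"
      by (intro integrable_mult_right integrable_exp) auto
    show "AE u in lborel. norm (indicator {0..} u * \<phi> u * u ^ n) \<le> norm (fact n * (indicator {0..} u * \<phi> u * exp (u * 1)))"
    proof (intro AE_I2)
      fix u :: real
      show "norm (indicator {0..} u * \<phi> u * u ^ n) \<le> norm (fact n * (indicator {0..} u * \<phi> u * exp (u * 1)))"
      proof (cases "u \<ge> 0")
        case True
        have "u ^ n / fact n \<le> exp u" 
        proof -
          have "(\<Sum>k\<in>{n}. u ^ k /\<^sub>R fact k) \<le> exp u"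
            unfolding exp_def by (intro sum_le_suminf summable_exp_generic) (use True in auto)
          then show ?thesis by (simp add: divide_inverse_commute)
        qed
        then have "\<phi> u * u ^ n \<le> \<phi> u * (fact n * exp u)"
          using nonneg[OF True] by (intro mult_left_mono) (auto simp: field_simps)
        then show ?thesis using True nonneg[OF True] by (simp add: abs_mult mult_ac)
      qed simp
    qed
  qed measurable
  have "(\<lambda>n. a n * (z - 0) ^ n) sums cos_transform \<phi> z" for z
  proof -
    define f where "f = (\<lambda>n u. complex_of_real (indicator {0..} u * \<phi> u) * (cos_coeff n *\<^sub>R (complex_of_real u * z) ^ n))"
    have intf: "integrable lborel (f n)" for n
    proof -
      have "integrable lborel (\<lambda>u. (cos_coeff n *\<^sub>R z ^ n) * complex_of_real (indicator {0..} u * \<phi> u * u ^ n))"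
        by (intro integrable_mult_right integrable_of_real int_pow)
      then show ?thesis by (simp add: f_def power_mult_distrib mult_ac scaleR_conv_of_real)
    qed
    have sumsf: "(\<lambda>n. f n u) sums (complex_of_real (indicator {0..} u * \<phi> u) * cos (complex_of_real u * z))" for u
      unfolding f_def by (intro sums_mult cos_converges)
    have normsf: "(\<Sum>n<N. norm (f n u)) \<le> indicator {0..} u * \<phi> u * exp (u * norm z)" for u N
    proof (cases "u \<ge> 0")
      case True
      have "norm (f n u) \<le> \<phi> u * ((u * norm z) ^ n /\<^sub>R fact n)" for n
      proof -
        have "\<bar>cos_coeff n\<bar> \<le> inverse (fact n)" by (auto simp: cos_coeff_def divide_inverse abs_mult)
        then have "\<phi> u * (\<bar>cos_coeff n\<bar> * (u * norm z) ^ n) \<le> \<phi> u * (inverse (fact n) * (u * norm z) ^ n)"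
          using True nonneg[OF True] by (intro mult_left_mono mult_right_mono) auto
        then show ?thesis using True nonneg[OF True] by (simp add: f_def norm_mult norm_power mult_ac)
      qed
      then have "(\<Sum>n<N. norm (f n u)) \<le> (\<Sum>n<N. \<phi> u * ((u * norm z) ^ n /\<^sub>R fact n))" by (intro sum_mono)
      also have "\<dots> = \<phi> u * (\<Sum>n<N. (u * norm z) ^ n /\<^sub>R fact n)" by (simp add: sum_distrib_left)
      also have "\<dots> \<le> \<phi> u * exp (u * norm z)"
      proof (rule mult_left_mono[OF _ nonneg[OF True]])
        show "(\<Sum>n<N. (u * norm z) ^ n /\<^sub>R fact n) \<le> exp (u * norm z)"
          unfolding exp_def by (intro sum_le_suminf summable_exp_generic) (use True in auto)
      qed
      finally show ?thesis using True by simp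
    qed (simp add: f_def)
    have "(\<lambda>N. \<integral>u. (\<Sum>n<N. f n u) \<partial>lborel) \<longlonglongrightarrow> (\<integral>u. complex_of_real (indicator {0..} u * \<phi> u) * cos (complex_of_real u * z) \<partial>lborel)"
    proof (rule integral_dominated_convergence)
      show "integrable lborel (\<lambda>u. indicator {0..} u * \<phi> u * exp (u * norm z))" by (rule integrable_exp) simp
      show "AE u in lborel. (\<lambda>N. \<Sum>n<N. f n u) \<longlonglongrightarrow> complex_of_real (indicator {0..} u * \<phi> u) * cos (complex_of_real u * z)"
        using sumsf by (simp add: sums_def)
      show "AE u in lborel. norm (\<Sum>n<N. f n u) \<le> indicator {0..} u * \<phi> u * exp (u * norm z)" for N
        using norm_sum normsf by (intro AE_I2) (rule order_trans)
      show "(\<lambda>u. \<Sum>n<N. f n u) \<in> borel_measurable lborel" for N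
        using intf by (intro borel_measurable_sum) auto
      show "(\<lambda>u. complex_of_real (indicator {0..} u * \<phi> u) * cos (complex_of_real u * z)) \<in> borel_measurable lborel"
        using integrable_cos[of z] by (simp add: scaleR_conv_of_real mult.assoc borel_measurable_integrable)
    qed
    moreover have "(\<integral>u. (\<Sum>n<N. f n u) \<partial>lborel) = (\<Sum>n<N. a n * (z - 0) ^ n)" for N
    proof -
      have "(\<integral>u. f n u \<partial>lborel) = a n * z ^ n" for n
      proof -
        have "(\<integral>u. f n u \<partial>lborel) = (\<integral>u. (cos_coeff n *\<^sub>R z ^ n) * complex_of_real (indicator {0..} u * \<phi> u * u ^ n) \<partial>lborel)"
          by (simp add: f_def power_mult_distrib mult_ac scaleR_conv_of_real)
        also have "\<dots> = (cos_coeff n *\<^sub>R z ^ n) * complex_of_real (\<integral>u. indicator {0..} u * \<phi> u * u ^ n \<partial>lborel)"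
          by (subst integral_mult_right_zero, subst integral_complex_of_real) simp
        finally show ?thesis by (simp add: a_def scaleR_conv_of_real mult_ac)
      qed
      then show ?thesis using intf by (simp add: Bochner_Integration.integral_sum)
    qed
    ultimately show ?thesis
      by (simp add: sums_def cos_transform_def set_lebesgue_integral_def scaleR_conv_of_real mult.assoc)
  qed
  then have "cos_transform \<phi> holomorphic_on ball 0 r" for r by (intro power_series_holomorphic)
  then show ?thesis
    by (metis (no_types, lifting) UNIV_I dist_0_norm holomorphic_on_open mem_ball open_UNIV open_ball reals_Archimedean2)
qed

lemma cos_transform_real: "cos_transform \<phi> (of_real t) \<in> \<real>"
proof -
  have "cos_transform \<phi> (of_real t) = (\<integral>u. complex_of_real (indicator {0..} u * (\<phi> u * cos (u * t))) \<partial>lborel)"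
    by (simp add: cos_transform_def set_lebesgue_integral_def scaleR_conv_of_real cos_of_real flip: of_real_mult)
  then show ?thesis by (simp only: integral_complex_of_real) simp
qed

end

section \<open>Riemann's integral formula for the xi function\<close>

lemma theta_tail_summable: "summable (\<lambda>n. exp (- pi * x * (real (Suc n))\<^sup>2))" if "x > 0"
proof -
  have "summable (\<lambda>n. exp (- (pi * x) * (real n)\<^sup>2) * 1 ^ n)"
    using that by (intro summable_gauss_powser) auto
  then show ?thesis by (subst (asm) summable_Suc_iff[symmetric]) (simp add: mult.assoc)
qed

definition theta_tail :: "real \<Rightarrow> real" where
  "theta_tail x = (\<Sum>n. exp (- pi * x * (real (Suc n))\<^sup>2))"

text \<open>
  The functional equation of theta in exponential coordinates, where inversion becomes \<open>u \<mapsto> -u\<close>.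
\<close>
lemma theta_tail_inversion:
  "theta_tail (exp (- 2 * u)) = exp u * theta_tail (exp (2 * u)) + (exp u - 1) / 2"
proof -
  have gauss: "gauss_series (pi * x) 1 = 1 + theta_tail x" if "x > 0" for x
  proof -
    have "summable (\<lambda>n. exp (- (pi * x) * (real n)\<^sup>2) * 1 ^ n)"
      using that by (intro summable_gauss_powser) auto
    from suminf_split_head[OF this] show ?thesis
      by (simp add: gauss_series_def theta_tail_def mult.assoc)
  qed
  have "1 + 2 * theta_tail (exp (2 * u)) = (1 + 2 * theta_tail (exp (- 2 * u))) / sqrt (exp (2 * u))"
    using theta_functional_equation[of "exp (2 * u)"] gauss[of "exp (2 * u)"] gauss[of "exp (- 2 * u)"]
    by (simp add: exp_minus divide_inverse)
  moreover have "sqrt (exp (2 * u)) = exp u"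
    by (rule real_sqrt_unique) (simp_all add: power2_eq_square flip: exp_add)
  ultimately show ?thesis by (simp add: field_simps)
qed

lemma theta_tail_nonneg: "theta_tail x \<ge> 0" if "x > 0"
  unfolding theta_tail_def by (intro suminf_nonneg theta_tail_summable that) simp

lemma theta_tail_bound: "theta_tail x \<le> exp (pi * (1 - x)) * theta_tail 1" if "x \<ge> 1"
proof -
  have "exp (- pi * x * (real (Suc n))\<^sup>2) \<le> exp (pi * (1 - x)) * exp (- pi * 1 * (real (Suc n))\<^sup>2)" for n
  proof -
    have "(x - 1) * 1 \<le> (x - 1) * (real (Suc n))\<^sup>2" using that by (intro mult_left_mono) auto
    then have "pi * (1 - x) + - pi * 1 * (real (Suc n))\<^sup>2 \<ge> - pi * x * (real (Suc n))\<^sup>2"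
      using mult_left_mono[of "(x - 1) * 1" "(x - 1) * (real (Suc n))\<^sup>2" pi]
      by (simp add: algebra_simps)
    then show ?thesis by (simp flip: exp_add)
  qed
  then have "theta_tail x \<le> (\<Sum>n. exp (pi * (1 - x)) * exp (- pi * 1 * (real (Suc n))\<^sup>2))"
    unfolding theta_tail_def using that by (intro suminf_le theta_tail_summable summable_mult) auto
  also have "\<dots> = exp (pi * (1 - x)) * theta_tail 1"
    unfolding theta_tail_def by (intro suminf_mult theta_tail_summable) auto
  finally show ?thesis .
qed

lemma theta_tail_measurable: "(\<lambda>u. theta_tail (exp (2 * u))) \<in> borel_measurable borel"
  unfolding theta_tail_def by measurable

text \<open>
  The factor \<open>exp (u / 2)\<close> symmetrises: it turns \<open>exp (s u) + exp ((1 - s) u)\<close> into a cosine in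
  \<open>t = -\<i> (s - 1/2)\<close>.
\<close>
definition Xi_kernel :: "real \<Rightarrow> real" where
  "Xi_kernel u = 4 * theta_tail (exp (2 * u)) * exp (u / 2)"

lemma set_integrable_exp_minus: "set_integrable lborel {0..} (\<lambda>u::real. exp (- a * u))" if "a > 0"
proof -
  have "set_integrable lebesgue {0..} (\<lambda>u::real. exp (- a * u))"
    by (intro nonnegative_absolutely_integrable_1 integrable_on_exp_minus_to_infinity that) auto
  then show ?thesis
    unfolding set_integrable_def by (subst (asm) integrable_completion) auto
qed

interpretation Xi_kernel: cubic_exp_integrable Xi_kernel
proof
  show "set_borel_measurable lborel {0..} Xi_kernel"
    unfolding set_borel_measurable_def Xi_kernel_def using theta_tail_measurable by simp
  show nonneg: "Xi_kernel u \<ge> 0" for u by (simp add: Xi_kernel_def theta_tail_nonneg)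
  show "set_integrable lborel {0..} (\<lambda>u. Xi_kernel u * exp (u ^ 3))"
  proof (rule set_integrable_bound)
    show "set_integrable lborel {0..} (\<lambda>u. (4 * (exp pi * theta_tail 1)) * exp (- 1 * u))"
      by (intro set_integrable_mult_right set_integrable_exp_minus) auto
    show "set_borel_measurable lborel {0..} (\<lambda>u. Xi_kernel u * exp (u ^ 3))"
      unfolding set_borel_measurable_def Xi_kernel_def using theta_tail_measurable by simp
    show "AE u in lborel. u \<in> {0..} \<longrightarrow>
       norm (Xi_kernel u * exp (u ^ 3)) \<le> norm ((4 * (exp pi * theta_tail 1)) * exp (- 1 * u))"
    proof (intro AE_I2 impI)
      fix u :: real assume "u \<in> {0..}"
      then have u: "u \<ge> 0" by simp
      \<comment> \<open>The cubic Taylor polynomial of \<open>exp (2 u)\<close> is enough to beat \<open>u / 2 + u ^ 3 + u\<close>.\<close>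
      have "(\<Sum>k<4. (2 * u) ^ k /\<^sub>R fact k) \<le> exp (2 * u)"
        unfolding exp_def by (intro sum_le_suminf summable_exp_generic) (use u in auto)
      then have "1 + 2 * u + 2 * u\<^sup>2 + 4/3 * u ^ 3 \<le> exp (2 * u)"
        by (simp add: eval_nat_numeral fact_numeral field_simps)
      moreover have "u\<^sup>2 \<ge> 0" "u ^ 3 \<ge> 0" using u by auto
      moreover have "2 * exp (2 * u) \<le> pi * exp (2 * u)"
        using pi_ge_two by (intro mult_right_mono) auto
      ultimately have "pi * (1 - exp (2 * u)) + u / 2 + u ^ 3 \<le> pi - u"
        using u unfolding right_diff_distrib by linarith
      then have e: "exp (pi * (1 - exp (2 * u))) * exp (u / 2) * exp (u ^ 3) \<le> exp pi * exp (- u)"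
        by (simp flip: exp_add)
      have "Xi_kernel u * exp (u ^ 3) \<le> 4 * (exp (pi * (1 - exp (2 * u))) * theta_tail 1) * exp (u / 2) * exp (u ^ 3)"
        unfolding Xi_kernel_def using u by (intro mult_right_mono mult_left_mono theta_tail_bound) auto
      also have "\<dots> = (exp (pi * (1 - exp (2 * u))) * exp (u / 2) * exp (u ^ 3)) * (4 * theta_tail 1)" by simp
      also have "\<dots> \<le> (exp pi * exp (- u)) * (4 * theta_tail 1)"
        by (intro mult_right_mono e) (simp add: theta_tail_nonneg)
      finally show "norm (Xi_kernel u * exp (u ^ 3)) \<le> norm ((4 * (exp pi * theta_tail 1)) * exp (- 1 * u))"
        using nonneg[of u] by (simp add: abs_mult theta_tail_nonneg mult_ac)
    qed
  qed
qed

text \<open>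
  Euler's integral after the substitution \<open>t = exp (2 u)\<close>, which turns the scaling of \<open>t\<close> into a
  translation of \<open>u\<close>.
\<close>
lemma Gamma_exp_integral:
  assumes w: "Re w > 0"
  shows "has_bochner_integral lborel (\<lambda>u. 2 * exp (2 * w * of_real u - of_real (exp (2 * u)))) (Gamma w)"
proof -
  let ?f = "\<lambda>t. complex_of_real t powr (w - 1) / of_real (exp t)"
  have range: "range (\<lambda>u::real. exp (2 * u)) = {0<..}"
  proof -
    have "y \<in> range (\<lambda>u::real. exp (2 * u))" if "y > 0" for y
      using that by (intro image_eqI[of _ _ "ln y / 2"]) auto
    then show ?thesis by auto
  qed
  have "?f absolutely_integrable_on range (\<lambda>u::real. exp (2 * u)) \<and> integral (range (\<lambda>u::real. exp (2 * u))) ?f = Gamma w"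
    unfolding range using absolutely_integrable_Gamma_integral'[OF w] Gamma_integral_complex'[OF w]
    by (auto simp: has_integral_iff)
  moreover have "((\<lambda>u. exp (2 * u)) has_field_derivative 2 * exp (2 * u)) (at u within UNIV)" for u :: real
    by (auto intro!: derivative_eq_intros)
  moreover have "inj (\<lambda>u::real. exp (2 * u))" by (auto simp: inj_on_def)
  ultimately have *: "(\<lambda>u. \<bar>2 * exp (2 * u)\<bar> *\<^sub>R ?f (exp (2 * u))) absolutely_integrable_on UNIV \<and>
       integral UNIV (\<lambda>u. \<bar>2 * exp (2 * u)\<bar> *\<^sub>R ?f (exp (2 * u))) = Gamma w"
    by (subst has_absolute_integral_change_of_variables_real[where g = "\<lambda>u. exp (2 * u)"]) auto
  have eq: "\<bar>2 * exp (2 * u)\<bar> *\<^sub>R ?f (exp (2 * u)) = 2 * exp (2 * w * of_real u - of_real (exp (2 * u)))" for u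
  proof -
    have "complex_of_real (exp (2 * u)) powr (w - 1) = exp ((w - 1) * of_real (2 * u))"
      by (subst powr_def) (simp add: Ln_of_real)
    then have "\<bar>2 * exp (2 * u)\<bar> *\<^sub>R ?f (exp (2 * u))
        = 2 * (complex_of_real (exp (2 * u)) * exp ((w - 1) * of_real (2 * u)) / complex_of_real (exp (exp (2 * u))))"
      by (simp add: scaleR_conv_of_real)
    also have "\<dots> = 2 * (exp (of_real (2 * u)) * exp ((w - 1) * of_real (2 * u)) / exp (of_real (exp (2 * u))))"
      by (simp only: exp_of_real)
    also have "\<dots> = 2 * exp (2 * w * of_real u - of_real (exp (2 * u)))"
      by (simp add: algebra_simps flip: exp_add exp_diff)
    finally show ?thesis .
  qed
  let ?h = "\<lambda>u. 2 * exp (2 * w * of_real u - complex_of_real (exp (2 * u)))"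
  have abs: "?h absolutely_integrable_on UNIV" and I: "integral UNIV ?h = Gamma w"
    using * unfolding eq by auto
  have "integrable lborel ?h"
    using abs unfolding set_integrable_def
    by (subst (asm) integrable_completion)
       (auto intro!: borel_measurable_continuous_onI continuous_intros)
  then show ?thesis
    using I integral_lborel[of ?h] by (simp add: has_bochner_integral_iff)
qed

text \<open>
  Translating \<open>u\<close> by \<open>ln (\<pi> (n + 1)\<^sup>2) / 2\<close> in Euler's integral produces the \<open>n\<close>-th term of the
  Dirichlet series of zeta.
\<close>
lemma Gamma_gauss_integral:
  assumes s: "Re s > 0"
  shows "has_bochner_integral lborel
    (\<lambda>u. 2 * of_real (exp (- pi * exp (2 * u) * (real (Suc n))\<^sup>2)) * exp (s * of_real u))
    (Gamma (s / 2) * of_real pi powr (- s / 2) * (1 / of_nat (Suc n) powr s))"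
proof -
  define c where "c = pi * (real (Suc n))\<^sup>2"
  have c: "c > 0" by (simp add: c_def)
  define d where "d = ln c / 2"
  let ?h = "\<lambda>u. 2 * exp (2 * (s / 2) * of_real u - complex_of_real (exp (2 * u)))"
  have "has_bochner_integral lborel ?h (Gamma (s / 2))"
    by (rule Gamma_exp_integral) (use s in simp)
  from lborel_has_bochner_integral_real_affine_iff[of 1, THEN iffD1, OF _ this, of d]
  have "has_bochner_integral lborel (\<lambda>u. ?h (d + u)) (Gamma (s / 2))" by simp
  then have H: "has_bochner_integral lborel (\<lambda>u. exp (- s * of_real d) * ?h (d + u)) (exp (- s * of_real d) * Gamma (s / 2))"
    by (rule has_bochner_integral_mult_right)
  have integrand: "exp (- s * of_real d) * ?h (d + u) = 2 * of_real (exp (- pi * exp (2 * u) * (real (Suc n))\<^sup>2)) * exp (s * of_real u)" for u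
  proof -
    have "exp (2 * (d + u)) = c * exp (2 * u)"
      using c by (simp add: d_def exp_add distrib_left)
    then have "exp (- s * of_real d) * ?h (d + u) = 2 * (exp (- s * of_real d) * exp (s * of_real (d + u) - of_real (c * exp (2 * u))))"
      by simp
    also have "\<dots> = 2 * exp (of_real (- c * exp (2 * u)) + s * of_real u)"
      by (simp add: algebra_simps flip: exp_add)
    also have "\<dots> = 2 * of_real (exp (- c * exp (2 * u))) * exp (s * of_real u)"
      by (simp only: exp_add exp_of_real mult.assoc)
    finally show ?thesis by (simp add: c_def mult_ac)
  qed
  have factor: "exp (- s * of_real d) = of_real pi powr (- s / 2) * (1 / of_nat (Suc n) powr s)"
  proof -
    have "d = ln pi / 2 + ln (real (Suc n))"
      by (simp add: d_def c_def ln_mult ln_realpow)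
    then have "- s * of_real d = - s / 2 * of_real (ln pi) + - (s * of_real (ln (real (Suc n))))"
      by (simp add: algebra_simps)
    then have "exp (- s * of_real d) = exp (- s / 2 * of_real (ln pi)) * (1 / exp (s * of_real (ln (real (Suc n)))))"
      by (simp only: exp_add exp_minus inverse_eq_divide)
    moreover have "complex_of_real pi powr (- s / 2) = exp (- s / 2 * of_real (ln pi))"
      by (simp add: powr_def Ln_of_real)
    moreover have "of_nat (Suc n) powr s = exp (s * of_real (ln (real (Suc n))))"
      using Ln_of_real[of "real (Suc n)"] by (simp add: powr_def del: of_nat_Suc)
    ultimately show ?thesis by simp
  qed
  show ?thesis using H unfolding integrand unfolding factor by (simp only: mult_ac)
qed

definition zeta_series :: "complex \<Rightarrow> complex" where
  "zeta_series s = (\<Sum>n. 1 / of_nat (Suc n) powr s)"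

text \<open>
  Sum over \<open>n\<close>. The integrals of the norms are the same integrals at the real point \<open>Re s\<close>, so they
  are summable precisely because \<open>Re s > 1\<close>.
\<close>
lemma theta_tail_Mellin:
  assumes s: "Re s > 1"
  shows "has_bochner_integral lborel (\<lambda>u. 2 * of_real (theta_tail (exp (2 * u))) * exp (s * of_real u))
     (Gamma (s / 2) * of_real pi powr (- s / 2) * zeta_series s)"
proof -
  define f where "f = (\<lambda>n u. 2 * complex_of_real (exp (- pi * exp (2 * u) * (real (Suc n))\<^sup>2)) * exp (s * of_real u))"
  define C where "C = Gamma (s / 2) * of_real pi powr (- s / 2)"
  have f: "has_bochner_integral lborel (f n) (C * (1 / of_nat (Suc n) powr s))" for n
    unfolding f_def C_def by (rule Gamma_gauss_integral) (use s in simp)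
  have norm_f: "norm (f n u) = 2 * exp (- pi * exp (2 * u) * (real (Suc n))\<^sup>2) * exp (Re s * u)" for n u
    unfolding f_def norm_mult by (simp add: norm_exp_eq_Re)
  define \<sigma> where "\<sigma> = complex_of_real (Re s)"
  define D where "D = Gamma (\<sigma> / 2) * of_real pi powr (- \<sigma> / 2)"
  have int_norm: "complex_of_real (\<integral>u. norm (f n u) \<partial>lborel) = D * of_real (real (Suc n) powr (- Re s))" for n
  proof -
    have "complex_of_real (\<integral>u. norm (f n u) \<partial>lborel) = (\<integral>u. complex_of_real (norm (f n u)) \<partial>lborel)"
      by simp
    also have "\<dots> = (\<integral>u. 2 * of_real (exp (- pi * exp (2 * u) * (real (Suc n))\<^sup>2)) * exp (\<sigma> * of_real u) \<partial>lborel)"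
      unfolding norm_f \<sigma>_def by (simp flip: exp_of_real)
    also have "\<dots> = D * (1 / of_nat (Suc n) powr \<sigma>)"
      unfolding D_def by (rule has_bochner_integral_integral_eq[OF Gamma_gauss_integral]) (use s in \<open>simp add: \<sigma>_def\<close>)
    also have "1 / of_nat (Suc n) powr \<sigma> = complex_of_real (real (Suc n) powr (- Re s))"
      using powr_of_real[of "real (Suc n)" "Re s"] by (simp add: \<sigma>_def powr_minus divide_inverse del: of_nat_Suc)
    finally show ?thesis .
  qed
  have "summable (\<lambda>n. real (Suc n) powr (- Re s))"
    using s by (subst summable_Suc_iff) (simp add: summable_real_powr_iff)
  then have summ: "summable (\<lambda>n. \<integral>u. norm (f n u) \<partial>lborel)"
  proof -
    have "(\<integral>u. norm (f n u) \<partial>lborel) = norm D * real (Suc n) powr (- Re s)" for n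
    proof -
      have "norm (complex_of_real (\<integral>u. norm (f n u) \<partial>lborel)) = (\<integral>u. norm (f n u) \<partial>lborel)"
        by simp
      then show ?thesis unfolding int_norm by (simp add: norm_mult)
    qed
    then show ?thesis using \<open>summable (\<lambda>n. real (Suc n) powr (- Re s))\<close> by (simp add: summable_mult)
  qed
  have AE: "AE u in lborel. summable (\<lambda>n. norm (f n u))"
    unfolding norm_f by (intro AE_I2 summable_mult2 summable_mult theta_tail_summable) simp
  have int: "integrable lborel (f n)" for n using f by (auto simp: has_bochner_integral_iff)
  have sum_f: "(\<Sum>n. f n u) = 2 * of_real (theta_tail (exp (2 * u))) * exp (s * of_real u)" for u
  proof -
    have "(\<lambda>n. exp (- pi * exp (2 * u) * (real (Suc n))\<^sup>2)) sums theta_tail (exp (2 * u))"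
      unfolding theta_tail_def by (intro summable_sums theta_tail_summable) simp
    then have "(\<lambda>n. f n u) sums (2 * of_real (theta_tail (exp (2 * u))) * exp (s * of_real u))"
      unfolding f_def by (intro sums_mult sums_mult2 sums_of_real)
    then show ?thesis by (rule sums_unique[symmetric])
  qed
  have C: "C \<noteq> 0"
    using s by (auto simp: C_def Gamma_eq_zero_iff elim!: nonpos_Ints_cases)
  have "(\<lambda>n. C * (1 / of_nat (Suc n) powr s)) sums (\<integral>u. (\<Sum>n. f n u) \<partial>lborel)"
    using sums_integral[OF int AE summ] by (simp only: has_bochner_integral_integral_eq[OF f])
  from sums_mult_D[OF this C] have "(\<integral>u. (\<Sum>n. f n u) \<partial>lborel) / C = zeta_series s"
    unfolding zeta_series_def by (rule sums_unique)
  then have "(\<integral>u. (\<Sum>n. f n u) \<partial>lborel) = C * zeta_series s"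
    using C by (simp add: field_simps)
  with integrable_suminf[OF int AE summ] show ?thesis
    unfolding sum_f by (simp add: has_bochner_integral_iff C_def)
qed


lemma integral_exp_half_line:
  assumes a: "Re a > 0"
  shows "set_integrable lborel {0..} (\<lambda>u. exp (- a * complex_of_real u))"
    and "(LINT u:{0..}|lborel. exp (- a * complex_of_real u)) = 1 / a"
proof -
  let ?f = "\<lambda>u. exp (- a * complex_of_real u)"
  have a0: "a \<noteq> 0" using a by auto
  have meas: "?f \<in> borel_measurable borel"
    by (intro borel_measurable_continuous_onI continuous_intros)
  show int: "set_integrable lborel {0..} ?f"
  proof (rule set_integrable_bound)
    show "set_integrable lborel {0..} (\<lambda>u::real. exp (- Re a * u))" by (rule set_integrable_exp_minus[OF a])
    show "set_borel_measurable lborel {0..} ?f"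
      using meas by (simp add: set_borel_measurable_def)
  qed simp
  have U: "(\<Union>n::nat. {0..real n}) = {0..}"
    by (auto simp: real_arch_simple)
  have "(\<lambda>n. LINT u:{0..real n}|lborel. ?f u) \<longlonglongrightarrow> (LINT u:(\<Union>n. {0..real n})|lborel. ?f u)"
    by (rule set_integral_cont_up) (use int in \<open>auto simp: incseq_def U\<close>)
  moreover have "(LINT u:{0..real n}|lborel. ?f u) = (1 - exp (- a * of_real (real n))) / a" for n
  proof -
    have "(?f has_integral (- exp (- a * of_real (real n)) / a - - exp (- a * of_real 0) / a)) {0..real n}"
    proof (rule fundamental_theorem_of_calculus)
      show "((\<lambda>u. - exp (- a * complex_of_real u) / a) has_vector_derivative ?f u) (at u within {0..real n})" for u
      proof -
        have "((\<lambda>z. - exp (- a * z) / a) has_field_derivative exp (- a * of_real u)) (at (of_real u))"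
          using a0 by (auto intro!: derivative_eq_intros)
        then show ?thesis by (rule has_vector_derivative_real_field)
      qed
    qed simp
    moreover have "set_integrable lborel {0..real n} ?f"
      by (rule set_integrable_subset[OF int]) auto
    ultimately show ?thesis
      by (simp add: set_borel_integral_eq_integral(2) integral_unique diff_divide_distrib)
  qed
  moreover have "(\<lambda>n. (1 - exp (- a * of_real (real n))) / a) \<longlonglongrightarrow> (1 - 0) / a"
  proof (intro tendsto_intros a0 tendsto_norm_zero_cancel[of "\<lambda>n. exp (- a * of_real (real n))"])
    have "(\<lambda>n. exp (- Re a * real n)) \<longlonglongrightarrow> 0" using a by real_asymp
    then show "(\<lambda>n. norm (exp (- a * of_real (real n)))) \<longlonglongrightarrow> 0" by simp
  qed
  ultimately show "(LINT u:{0..}|lborel. ?f u) = 1 / a"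
    unfolding U by (simp add: LIMSEQ_unique)
qed

lemma integral_fold_half_line:
  fixes h :: "real \<Rightarrow> complex"
  assumes "has_bochner_integral lborel h I"
  shows "set_integrable lborel {0..} (\<lambda>u. h u + h (- u))"
    and "(LINT u:{0..}|lborel. h u + h (- u)) = I"
proof -
  have h: "integrable lborel h" "integral\<^sup>L lborel h = I" using assms by (auto simp: has_bochner_integral_iff)
  have h': "has_bochner_integral lborel (\<lambda>u. h (- u)) I"
    using lborel_has_bochner_integral_real_affine_iff[of "-1" h I 0] assms by simp
  have intA: "set_integrable lborel A h" "set_integrable lborel A (\<lambda>u. h (- u))" if "A \<in> sets borel" for A
    using h(1) h' that by (auto simp: set_integrable_def has_bochner_integral_iff intro!: integrable_mult_indicator)
  show "set_integrable lborel {0..} (\<lambda>u. h u + h (- u))" by (intro set_integral_add intA) auto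
  have refl: "(LINT u:{0..}|lborel. h (- u)) = (LINT u:{..0}|lborel. h u)"
  proof -
    have "(LINT u:{..0}|lborel. h u) = (\<integral>u. indicator {..0} (0 + (-1) * u) *\<^sub>R h (0 + (-1) * u) \<partial>lborel)"
      unfolding set_lebesgue_integral_def
      by (subst lborel_integral_real_affine[of "-1" _ 0]) auto
    also have "\<dots> = (LINT u:{0..}|lborel. h (- u))"
      unfolding set_lebesgue_integral_def
      by (intro Bochner_Integration.integral_cong) (auto simp: indicator_def)
    finally show ?thesis ..
  qed
  have null: "(LINT u:{..0}|lborel. h u) = (LINT u:{..<0}|lborel. h u)"
    unfolding set_lebesgue_integral_def
  proof (rule integral_cong_AE)
    show "AE u in lborel. indicat_real {..0} u *\<^sub>R h u = indicat_real {..<0} u *\<^sub>R h u"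
      using AE_lborel_singleton[of 0] by eventually_elim (auto simp: indicator_def)
  qed (use h(1) in auto)
  have "I = (LINT u:{..<0} \<union> {0..}|lborel. h u)"
  proof -
    have "{..<0} \<union> {0..} = (UNIV :: real set)" by auto
    then show ?thesis using h(2) by (simp add: set_lebesgue_integral_def)
  qed
  also have "\<dots> = (LINT u:{..<0}|lborel. h u) + (LINT u:{0..}|lborel. h u)"
    by (intro set_integral_Un intA) auto
  also have "\<dots> = (LINT u:{0..}|lborel. h u) + (LINT u:{0..}|lborel. h (- u))"
    by (simp add: refl null)
  also have "\<dots> = (LINT u:{0..}|lborel. h u + h (- u))"
    by (intro set_integral_add(2)[symmetric] intA) auto
  finally show "(LINT u:{0..}|lborel. h u + h (- u)) = I" ..
qed

text \<open>
  Riemann's argument: fold the Mellin integral at \<open>0\<close> and replace \<open>u \<mapsto> -u\<close> in the theta function by its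
  functional equation. The two elementary terms that appear integrate to the polar parts
  \<open>1 / (s - 1)\<close> and \<open>-1 / s\<close>.
\<close>
lemma completed_zeta_series:
  assumes s: "Re s > 1"
  shows "Gamma (s / 2) * of_real pi powr (- s / 2) * zeta_series s
     = cos_transform Xi_kernel (- \<i> * (s - 1/2)) + 1 / (s - 1) - 1 / s"
proof -
  define h where "h = (\<lambda>u. 2 * complex_of_real (theta_tail (exp (2 * u))) * exp (s * of_real u))"
  define z where "z = - \<i> * (s - 1/2)"
  have fold: "h u + h (- u) = of_real (Xi_kernel u) * cos (of_real u * z) + exp (- (s - 1) * of_real u) - exp (- s * of_real u)" for u
  proof -
    let ?w = "complex_of_real (theta_tail (exp (2 * u)))"
    have T: "complex_of_real (theta_tail (exp (2 * - u))) = exp (of_real u) * ?w + (exp (of_real u) - 1) / 2"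
      using arg_cong[OF theta_tail_inversion[of u], of complex_of_real] by (simp add: exp_of_real)
    have "h u + h (- u) = 2 * ?w * exp (s * of_real u) + 2 * (exp (of_real u) * ?w + (exp (of_real u) - 1) / 2) * exp (- s * of_real u)"
      unfolding h_def T by simp
    also have "\<dots> = 2 * ?w * (exp (s * of_real u) + exp (of_real u) * exp (- s * of_real u))
       + (exp (of_real u) * exp (- s * of_real u) - exp (- s * of_real u))"
      by (simp add: field_simps)
    also have "exp (of_real u) * exp (- s * of_real u) = exp (- (s - 1) * of_real u)"
      by (simp add: algebra_simps flip: exp_add)
    also have "exp (s * of_real u) + exp (- (s - 1) * of_real u) = 2 * exp (of_real (u / 2)) * cos (of_real u * z)"
    proof -
      have "\<i> * (of_real u * z) = of_real u * (s - 1/2)" by (simp add: z_def algebra_simps)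
      then have "cos (of_real u * z) = (exp (of_real u * (s - 1/2)) + exp (- (of_real u * (s - 1/2)))) / 2"
        by (simp only: cos_exp_eq)
      then have "2 * exp (of_real (u / 2)) * cos (of_real u * z)
          = exp (of_real (u / 2)) * (exp (of_real u * (s - 1/2)) + exp (- (of_real u * (s - 1/2))))"
        by (simp add: mult.commute)
      also have "\<dots> = exp (of_real (u / 2) + of_real u * (s - 1/2)) + exp (of_real (u / 2) - of_real u * (s - 1/2))"
        by (simp add: distrib_left flip: exp_add)
      finally show ?thesis by (simp add: algebra_simps)
    qed
    also have "2 * ?w * (2 * exp (of_real (u / 2)) * cos (of_real u * z)) = of_real (Xi_kernel u) * cos (of_real u * z)"
      using exp_of_real[of "u / 2", where ?'a = complex] by (simp add: Xi_kernel_def)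
    finally show ?thesis by simp
  qed
  note H = integral_fold_half_line[OF theta_tail_Mellin[OF s, folded h_def]]
  have "Gamma (s / 2) * of_real pi powr (- s / 2) * zeta_series s = (LINT u:{0..}|lborel. h u + h (- u))"
    by (simp only: H(2))
  also have "\<dots> = cos_transform Xi_kernel z + (LINT u:{0..}|lborel. exp (- (s - 1) * of_real u)) - (LINT u:{0..}|lborel. exp (- s * of_real u))"
  proof -
    have i1: "set_integrable lborel {0..} (\<lambda>u. of_real (Xi_kernel u) * cos (of_real u * z))"
      unfolding set_integrable_def by (rule Xi_kernel.integrable_cos)
    have i2: "set_integrable lborel {0..} (\<lambda>u. exp (- (s - 1) * complex_of_real u))"
      by (rule integral_exp_half_line(1)) (use s in simp)
    have i3: "set_integrable lborel {0..} (\<lambda>u. exp (- s * complex_of_real u))"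
      by (rule integral_exp_half_line(1)) (use s in simp)
    show ?thesis
      unfolding fold cos_transform_def
      by (simp only: set_integral_diff(2)[OF set_integral_add(1)[OF i1 i2] i3] set_integral_add(2)[OF i1 i2])
  qed
  also have "\<dots> = cos_transform Xi_kernel z + 1 / (s - 1) - 1 / s"
  proof -
    have "(LINT u:{0..}|lborel. exp (- (s - 1) * complex_of_real u)) = 1 / (s - 1)"
      by (rule integral_exp_half_line(2)) (use s in simp)
    moreover have "(LINT u:{0..}|lborel. exp (- s * complex_of_real u)) = 1 / s"
      by (rule integral_exp_half_line(2)) (use s in simp)
    ultimately show ?thesis by (simp only:)
  qed
  finally show ?thesis by (simp only: z_def)
qed

definition xi_entire :: "complex \<Rightarrow> complex" where
  "xi_entire s = 1 / 2 + s * (s - 1) / 2 * cos_transform Xi_kernel (- \<i> * (s - 1/2))"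

lemma xi_entire_holomorphic: "xi_entire holomorphic_on A"
proof -
  have "(\<lambda>s. cos_transform Xi_kernel (- \<i> * (s - 1/2))) holomorphic_on A"
    by (rule holomorphic_on_compose_gen[OF _ Xi_kernel.cos_transform_holomorphic, unfolded o_def])
       (auto intro!: holomorphic_intros)
  then show ?thesis unfolding xi_entire_def by (intro holomorphic_intros) auto
qed

text \<open>
  The factor \<open>s (s - 1) / 2\<close> cancels the polar parts, since
  \<open>1 / (s - 1) - 1 / s = 1 / (s (s - 1))\<close>.
\<close>
lemma xi_entire_eq:
  assumes s: "Re s > 1"
  shows "xi_entire s = s * (s - 1) / 2 * (Gamma (s / 2) * of_real pi powr (- s / 2) * zeta_series s)"
proof -
  have "s \<noteq> 0" "s - 1 \<noteq> 0" using s by auto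
  then show ?thesis
    unfolding completed_zeta_series[OF s] xi_entire_def by (simp add: field_simps)
qed

text \<open>
  The formula for \<open>\<xi>\<close> solved for zeta. The factor \<open>s / 2\<close> has been merged into
  \<open>\<Gamma>(s/2 + 1)\<close>, whose reciprocal is entire, so that only the pole at \<open>1\<close> remains; the value there
  matches the normalisation in the definition of zeta.
\<close>
definition zeta_cont :: "complex \<Rightarrow> complex" where
  "zeta_cont s = (if s = 1 then 0 else xi_entire s * of_real pi powr (s / 2) * rGamma (s / 2 + 1) / (s - 1))"

lemma riemann_zeta_eq: "riemann_zeta = zeta_cont"
  unfolding riemann_zeta_def
proof (rule the_equality)
  have hol: "zeta_cont holomorphic_on - {1}"
  proof -
    have "(\<lambda>s. xi_entire s * of_real pi powr (s / 2) * rGamma (s / 2 + 1) / (s - 1)) holomorphic_on - {1}"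
      by (intro holomorphic_intros xi_entire_holomorphic) auto
    then show ?thesis by (rule holomorphic_transform) (auto simp: zeta_cont_def)
  qed
  have eq: "zeta_cont s = (\<Sum>n. 1 / of_nat (Suc n) powr s)" if s: "Re s > 1" for s
  proof -
    have ne: "s \<noteq> 0" "s - 1 \<noteq> 0" using s by auto
    have G: "Gamma (s / 2) \<noteq> 0"
      using s by (auto simp: Gamma_eq_zero_iff elim!: nonpos_Ints_cases)
    have "s / 2 * rGamma (s / 2 + 1) * Gamma (s / 2) = 1"
      unfolding rGamma_plus1 using G by (simp add: rGamma_inverse_Gamma)
    moreover have "of_real pi powr (- s / 2) * of_real pi powr (s / 2) = (1 :: complex)"
      by (simp flip: powr_add)
    moreover have "zeta_cont s = (of_real pi powr (- s / 2) * of_real pi powr (s / 2)) * (s / 2 * rGamma (s / 2 + 1) * Gamma (s / 2)) * zeta_series s"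
      using ne s by (auto simp: zeta_cont_def xi_entire_eq[OF s] divide_simps)
    ultimately show ?thesis by (simp add: zeta_series_def)
  qed
  show "zeta_cont holomorphic_on - {1} \<and>
    (\<forall>s. 1 < Re s \<longrightarrow> zeta_cont s = (\<Sum>n. 1 / of_nat (Suc n) powr s)) \<and> zeta_cont 1 = 0"
    using hol eq by (auto simp: zeta_cont_def)
  fix f assume f: "f holomorphic_on - {1} \<and> (\<forall>s. 1 < Re s \<longrightarrow> f s = (\<Sum>n. 1 / of_nat (Suc n) powr s)) \<and> f 1 = 0"
  show "f = zeta_cont"
  proof
    fix s
    show "f s = zeta_cont s"
    proof (cases "s = 1")
      case False
      show ?thesis
      proof (rule analytic_continuation_open[of "{s. Re s > 1}" "- {1}" f zeta_cont])
        show "open {s. Re s > 1}" by (rule open_halfspace_Re_gt)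
        have "2 \<in> {s. Re s > 1}" by simp
        then show "{s. Re s > 1} \<noteq> {}" by blast
        show "connected (- {1 :: complex})" by (intro connected_punctured_universe) simp
      qed (use f hol eq False in auto)
    qed (use f in \<open>simp add: zeta_cont_def\<close>)
  qed
qed

text \<open>
  Off the integers the defining product has no singular factor and agrees with the entire function;
  at the integers the removal of singularities takes the limit.
\<close>
lemma riemann_xi_eq: "riemann_xi = xi_entire"
proof
  fix s :: complex
  define F where "F = (\<lambda>s. 1/2 * s * (s - 1) * of_real pi powr (- s / 2) * Gamma (s / 2) * riemann_zeta s)"
  have F: "F z = xi_entire z" if z: "z \<notin> \<int>" for z
  proof -
    have ne: "z \<noteq> 0" "z - 1 \<noteq> 0" "z \<noteq> 1" using z by auto
    have "z / 2 \<notin> \<int>\<^sub>\<le>\<^sub>0"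
    proof
      assume "z / 2 \<in> \<int>\<^sub>\<le>\<^sub>0"
      then have "2 * (z / 2) \<in> \<int>" by (intro Ints_mult) (auto dest: nonpos_Ints_Int)
      then show False using z by simp
    qed
    then have "z / 2 * rGamma (z / 2 + 1) * Gamma (z / 2) = 1"
      unfolding rGamma_plus1 by (simp add: rGamma_inverse_Gamma Gamma_eq_zero_iff)
    moreover have "of_real pi powr (- z / 2) * of_real pi powr (z / 2) = (1 :: complex)"
      by (simp flip: powr_add)
    moreover have "F z = (of_real pi powr (- z / 2) * of_real pi powr (z / 2)) * (z / 2 * rGamma (z / 2 + 1) * Gamma (z / 2)) * xi_entire z"
      using ne by (simp add: F_def riemann_zeta_eq zeta_cont_def)
    ultimately show ?thesis by simp
  qed
  have "\<not> s islimpt \<int>"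
    by (rule discrete_imp_not_islimpt[of 1]) (auto elim!: Ints_cases simp: dist_of_int)
  then have "\<forall>\<^sub>F z in at s. z \<notin> \<int>" by (simp add: islimpt_iff_eventually)
  then have eq: "\<forall>\<^sub>F z in at s. xi_entire z = F z" by eventually_elim (simp add: F)
  have "xi_entire \<midarrow>s\<rightarrow> xi_entire s"
    using holomorphic_on_imp_continuous_on[OF xi_entire_holomorphic[of UNIV]]
    by (simp add: continuous_on_def)
  then have "F \<midarrow>s\<rightarrow> xi_entire s" using eq by (rule Lim_transform_eventually)
  then show "riemann_xi s = xi_entire s"
    unfolding riemann_xi_def F_def by (rule remove_sings_eqI)
qed

lemma riemann_Xi_eq: "riemann_Xi t = 1 / 2 - (t\<^sup>2 + 1/4) / 2 * cos_transform Xi_kernel t"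
proof -
  have "- \<i> * (1/2 + \<i> * t - 1/2) = t" by (simp add: algebra_simps)
  moreover have "(1/2 + \<i> * t) * (1/2 + \<i> * t - 1) = - (t\<^sup>2 + 1/4)"
    by (simp add: algebra_simps power2_eq_square)
  ultimately show ?thesis
    unfolding riemann_Xi_def riemann_xi_eq xi_entire_def by (simp only:) (simp add: field_simps)
qed

lemma riemann_Xi_holomorphic: "riemann_Xi holomorphic_on A"
proof -
  have "cos_transform Xi_kernel holomorphic_on A"
    by (rule holomorphic_on_subset[OF Xi_kernel.cos_transform_holomorphic]) simp
  then have "(\<lambda>t. 1 / 2 - (t\<^sup>2 + 1/4) / 2 * cos_transform Xi_kernel t) holomorphic_on A"
    by (intro holomorphic_intros) auto
  then show ?thesis by (rule holomorphic_transform) (simp add: riemann_Xi_eq)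
qed

lemma riemann_Xi_real: "riemann_Xi (of_real t) \<in> \<real>"
proof -
  have "((complex_of_real t)\<^sup>2 + 1/4) / 2 = of_real ((t\<^sup>2 + 1/4) / 2)" by simp
  then have "((complex_of_real t)\<^sup>2 + 1/4) / 2 \<in> \<real>" by (simp only: Reals_of_real)
  then show ?thesis
    unfolding riemann_Xi_eq by (intro Reals_diff Reals_mult Xi_kernel.cos_transform_real) simp_all
qed

text \<open>
  The polynomial factor is absorbed by two further factors \<open>exp ((1 + |z|)\<^sup>3\<^sup>/\<^sup>2)\<close>, whence the constant \<open>3\<close>.
\<close>
lemma riemann_Xi_bound:
  obtains B where "\<And>z. norm (riemann_Xi z) \<le> B * exp (3 * (1 + norm z) powr (3/2))"
proof -
  define M where "M = (LINT u:{0..}|lborel. Xi_kernel u * exp (u ^ 3))"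
  have M: "M \<ge> 0" unfolding M_def
    unfolding set_lebesgue_integral_def
    by (rule Bochner_Integration.integral_nonneg) (auto simp: indicator_def Xi_kernel.nonneg)
  show thesis
  proof (rule that[of "1 + M"])
    fix z :: complex
    define r where "r = 1 + norm z"
    define E where "E = exp (r powr (3/2))"
    have r: "r \<ge> 1" "norm z \<le> r" by (auto simp: r_def)
    have "r \<le> r powr (3/2)" using r powr_mono[of 1 "3/2" r] by simp
    also have "\<dots> \<le> E" unfolding E_def using exp_ge_add_one_self[of "r powr (3/2)"] by linarith
    finally have rE: "r \<le> E" .
    have E1: "E \<ge> 1" using rE r by simp
    have "norm (cos_transform Xi_kernel z) \<le> M * exp (norm z powr (3/2))"
      unfolding M_def by (rule Xi_kernel.cos_transform_bound)
    also have "\<dots> \<le> M * E"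
      unfolding E_def using r M by (intro mult_left_mono) (auto intro!: powr_mono2)
    finally have C: "norm (cos_transform Xi_kernel z) \<le> M * E" .
    have "norm (z\<^sup>2 + 1/4) \<le> (norm z)\<^sup>2 + 1/4"
      using norm_triangle_ineq[of "z\<^sup>2" "1/4"] by (simp add: norm_power)
    also have "\<dots> \<le> r\<^sup>2" by (simp add: r_def power2_eq_square algebra_simps)
    also have "\<dots> \<le> E\<^sup>2" using rE r by (intro power_mono) auto
    finally have P: "norm (z\<^sup>2 + 1/4) \<le> E\<^sup>2" .
    have "norm (riemann_Xi z) \<le> 1/2 + norm ((z\<^sup>2 + 1/4) / 2 * cos_transform Xi_kernel z)"
      unfolding riemann_Xi_eq by (rule order_trans[OF norm_triangle_ineq4]) simp
    also have "\<dots> = 1/2 + norm (z\<^sup>2 + 1/4) * norm (cos_transform Xi_kernel z) / 2"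
      by (simp add: norm_mult norm_divide)
    also have "\<dots> \<le> 1/2 + E\<^sup>2 * (M * E) / 2"
      by (intro add_left_mono divide_right_mono mult_mono P C) auto
    also have "\<dots> = 1/2 + M * E ^ 3 / 2" by (simp add: power2_eq_square power3_eq_cube)
    also have "\<dots> \<le> E ^ 3 + M * E ^ 3"
    proof -
      have "1 \<le> E ^ 3" using E1 by (rule one_le_power)
      moreover have "0 \<le> M * E ^ 3" using M E1 by simp
      ultimately show ?thesis by linarith
    qed
    also have "\<dots> = (1 + M) * exp (3 * (1 + norm z) powr (3/2))"
      by (simp add: E_def r_def algebra_simps flip: exp_of_nat_mult)
    finally show "norm (riemann_Xi z) \<le> (1 + M) * exp (3 * (1 + norm z) powr (3/2))" .
  qed
qed

section \<open>Zeros and the second derivative of the logarithm of an entire function\<close>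

text \<open>
  The second derivative of \<open>ln f\<close>, written without a choice of logarithm.
\<close>
definition deriv_logderiv :: "(complex \<Rightarrow> complex) \<Rightarrow> complex \<Rightarrow> complex" where
  "deriv_logderiv f = deriv (\<lambda>z. deriv f z / f z)"

lemma deriv_logderiv_mult:
  assumes f: "f holomorphic_on UNIV" and g: "g holomorphic_on UNIV" and nz: "f c \<noteq> 0" "g c \<noteq> 0"
  shows "deriv_logderiv (\<lambda>z. f z * g z) c = deriv_logderiv f c + deriv_logderiv g c"
proof -
  have fa: "f analytic_on A" and ga: "g analytic_on A" for A
    using f g analytic_on_subset[of _ UNIV A] by (auto simp: analytic_on_open)
  have "isCont f c" "isCont g c"
    by (rule analytic_at_imp_isCont[OF fa] analytic_at_imp_isCont[OF ga])+
  moreover have "eventually (\<lambda>z. k z \<noteq> 0) (nhds c)" if "isCont k c" "k c \<noteq> 0" for k :: "complex \<Rightarrow> complex"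
    using tendsto_imp_eventually_ne[OF that(1)[unfolded isCont_def] that(2)]
    unfolding eventually_at_filter
  proof eventually_elim
    case (elim z)
    then show ?case using that(2) by (cases "z = c") auto
  qed
  ultimately have ev: "eventually (\<lambda>z. f z \<noteq> 0 \<and> g z \<noteq> 0) (nhds c)"
    using nz by (intro eventually_conj) auto
  have "deriv_logderiv (\<lambda>z. f z * g z) c = deriv (\<lambda>z. deriv f z / f z + deriv g z / g z) c"
    unfolding deriv_logderiv_def
  proof (rule deriv_cong_ev)
    show "\<forall>\<^sub>F z in nhds c. deriv (\<lambda>z. f z * g z) z / (f z * g z) = deriv f z / f z + deriv g z / g z"
      using ev
    proof eventually_elim
      case (elim z)
      have "deriv (\<lambda>z. f z * g z) z = f z * deriv g z + deriv f z * g z"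
        by (intro deriv_mult analytic_on_imp_differentiable_at[OF fa[of UNIV]]
              analytic_on_imp_differentiable_at[OF ga[of UNIV]]) auto
      with elim show ?case by (simp add: field_simps)
    qed
  qed simp
  also have "\<dots> = deriv_logderiv f c + deriv_logderiv g c"
    unfolding deriv_logderiv_def
    using nz
    by (intro deriv_add analytic_on_imp_differentiable_at[of _ "{c}"] analytic_intros fa ga) auto
  finally show ?thesis .
qed

lemma deriv_logderiv_linear_power:
  assumes "c \<noteq> \<rho>"
  shows "deriv_logderiv (\<lambda>z. (z - \<rho>) ^ m) c = - of_nat m / (c - \<rho>)\<^sup>2"
proof -
  have "deriv_logderiv (\<lambda>z. (z - \<rho>) ^ m) c = deriv (\<lambda>z. of_nat m / (z - \<rho>)) c"
    unfolding deriv_logderiv_def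
  proof (rule deriv_cong_ev)
    have "\<forall>\<^sub>F z in nhds c. z \<noteq> \<rho>"
      using assms by (intro t1_space_nhds)
    then show "\<forall>\<^sub>F z in nhds c. deriv (\<lambda>z. (z - \<rho>) ^ m) z / (z - \<rho>) ^ m = of_nat m / (z - \<rho>)"
    proof eventually_elim
      case (elim z)
      have "deriv (\<lambda>z. (z - \<rho>) ^ m) z = of_nat m * (z - \<rho>) ^ (m - 1)"
        by (intro DERIV_imp_deriv) (auto intro!: derivative_eq_intros)
      with elim show ?case
        by (cases m) (auto simp: field_simps)
    qed
  qed simp
  also have "\<dots> = - of_nat m / (c - \<rho>)\<^sup>2"
    using assms by (intro DERIV_imp_deriv) (auto intro!: derivative_eq_intros simp: power2_eq_square)
  finally show ?thesis .
qed

lemma entire_split_zero: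
  assumes h: "h holomorphic_on UNIV" and nz: "h c \<noteq> 0"
  obtains g n where "g holomorphic_on UNIV" "\<And>z. h z = g z * (z - \<rho>) ^ n" "g \<rho> \<noteq> 0"
proof -
  define n where "n = nat (zorder h \<rho>)"
  define k where "k = zor_poly h \<rho>"
  have *: "(if h \<rho> = 0 then zorder h \<rho> > 0 else zorder h \<rho> = 0) \<and>
    (\<exists>r. r>0 \<and> cball \<rho> r \<subseteq> UNIV \<and> k holomorphic_on cball \<rho> r
    \<and> (\<forall>w\<in>cball \<rho> r. h w  = k w * (w-\<rho>) ^ n \<and> k w \<noteq>0))"
    unfolding n_def k_def by (rule zorder_exist_zero[OF h]) (use nz in auto)
  then obtain r where r: "r > 0" "k holomorphic_on cball \<rho> r"
    "\<And>w. w \<in> cball \<rho> r \<Longrightarrow> h w = k w * (w-\<rho>) ^ n" "\<And>w. w \<in> cball \<rho> r \<Longrightarrow> k w \<noteq> 0"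
    by blast
  define g where "g = (\<lambda>z. if z \<in> ball \<rho> r then k z else h z / (z - \<rho>) ^ n)"
  have "g holomorphic_on (ball \<rho> r \<union> - {\<rho>})"
    unfolding g_def
  proof (rule holomorphic_on_If_Un)
    show "k holomorphic_on ball \<rho> r" using r(2) by (rule holomorphic_on_subset) auto
    show "(\<lambda>z. h z / (z - \<rho>) ^ n) holomorphic_on - {\<rho>}"
      by (intro holomorphic_intros holomorphic_on_subset[OF h]) auto
    show "k z = h z / (z - \<rho>) ^ n" if "z \<in> ball \<rho> r" "z \<in> - {\<rho>}" for z
      using that r(3)[of z] by auto
  qed auto
  moreover have "ball \<rho> r \<union> - {\<rho>} = UNIV" using r(1) by auto
  ultimately have "g holomorphic_on UNIV" by simp
  moreover have "h z = g z * (z - \<rho>) ^ n" for z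
    using r(1) r(3)[of z] by (auto simp: g_def)
  moreover have "g \<rho> \<noteq> 0" using r(1) r(4)[of \<rho>] by (auto simp: g_def)
  ultimately show thesis using that by blast
qed

text \<open>
  Splitting off the zeros one at a time; the exponents are arbitrary at first and are recognised
  as the orders of the zeros at the end.
\<close>
lemma entire_split_zeros:
  assumes h: "h holomorphic_on UNIV" and nz: "h c \<noteq> 0" and "finite Z"
  obtains g m where "g holomorphic_on UNIV" "\<And>z. h z = g z * (\<Prod>\<rho>\<in>Z. (z - \<rho>) ^ m \<rho>)"
    "\<And>\<rho>. \<rho> \<in> Z \<Longrightarrow> g \<rho> \<noteq> 0" "\<And>\<rho>. \<rho> \<in> Z \<Longrightarrow> zorder h \<rho> = int (m \<rho>)"
proof -
  have "\<exists>g m. g holomorphic_on UNIV \<and> (\<forall>z. h z = g z * (\<Prod>\<rho>\<in>Z. (z - \<rho>) ^ m \<rho>)) \<and>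
          (\<forall>\<rho>\<in>Z. g \<rho> \<noteq> 0)"
    using \<open>finite Z\<close>
  proof induction
    case empty
    show ?case using h by (intro exI[of _ h]) auto
  next
    case (insert \<rho> Z)
    then obtain g m where g: "g holomorphic_on UNIV" "\<And>z. h z = g z * (\<Prod>\<rho>\<in>Z. (z - \<rho>) ^ m \<rho>)"
      "\<And>\<rho>. \<rho> \<in> Z \<Longrightarrow> g \<rho> \<noteq> 0" by blast
    have "g c \<noteq> 0" using nz g(2)[of c] by auto
    then obtain k n where k: "k holomorphic_on UNIV" "\<And>z. g z = k z * (z - \<rho>) ^ n" "k \<rho> \<noteq> 0"
      using entire_split_zero[OF g(1)] by blast
    have "h z = k z * (\<Prod>\<rho>'\<in>insert \<rho> Z. (z - \<rho>') ^ (m(\<rho> := n)) \<rho>')" for z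
    proof -
      have "(\<Prod>\<rho>'\<in>Z. (z - \<rho>') ^ (m(\<rho> := n)) \<rho>') = (\<Prod>\<rho>'\<in>Z. (z - \<rho>') ^ m \<rho>')"
        using insert.hyps by (intro prod.cong) auto
      then show ?thesis using insert.hyps g(2)[of z] k(2)[of z] by simp
    qed
    moreover have "k \<rho>' \<noteq> 0" if "\<rho>' \<in> insert \<rho> Z" for \<rho>'
      using that k(3) k(2)[of \<rho>'] g(3)[of \<rho>'] by auto
    ultimately show ?case using k(1) by blast
  qed
  then obtain g m where g: "g holomorphic_on UNIV" "\<And>z. h z = g z * (\<Prod>\<rho>\<in>Z. (z - \<rho>) ^ m \<rho>)"
      "\<And>\<rho>. \<rho> \<in> Z \<Longrightarrow> g \<rho> \<noteq> 0" by blast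
  have "zorder h \<rho> = int (m \<rho>)" if "\<rho> \<in> Z" for \<rho>
  proof (rule zorder_eqI)
    let ?k = "\<lambda>z. g z * (\<Prod>\<rho>'\<in>Z-{\<rho>}. (z - \<rho>') ^ m \<rho>')"
    show "?k holomorphic_on UNIV" using g(1) by (intro holomorphic_intros)
    show "?k \<rho> \<noteq> 0" using g(3)[OF that] \<open>finite Z\<close> by auto
    show "h w = ?k w * (w - \<rho>) powi int (m \<rho>)" for w
      using g(2)[of w] prod.remove[OF \<open>finite Z\<close> that, of "\<lambda>\<rho>'. (w - \<rho>') ^ m \<rho>'"]
      by (simp add: mult_ac)
  qed auto
  with g show thesis using that by blast
qed

lemma deriv_logderiv_split_zeros:
  assumes g: "g holomorphic_on UNIV" and "g c \<noteq> 0" and "finite Z" "c \<notin> Z"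
  shows "deriv_logderiv (\<lambda>z. g z * (\<Prod>\<rho>\<in>Z. (z - \<rho>) ^ m \<rho>)) c
           = deriv_logderiv g c - (\<Sum>\<rho>\<in>Z. of_nat (m \<rho>) / (\<rho> - c)\<^sup>2)"
  using \<open>finite Z\<close> \<open>c \<notin> Z\<close>
proof induction
  case (insert \<rho> Z)
  let ?f = "\<lambda>z. g z * (\<Prod>\<rho>\<in>Z. (z - \<rho>) ^ m \<rho>)"
  have "deriv_logderiv (\<lambda>z. ?f z * (z - \<rho>) ^ m \<rho>) c = deriv_logderiv ?f c + deriv_logderiv (\<lambda>z. (z - \<rho>) ^ m \<rho>) c"
    using assms(1,2) insert.prems insert.hyps
    by (intro deriv_logderiv_mult holomorphic_intros) auto
  then show ?case
    using insert deriv_logderiv_linear_power[of c \<rho> "m \<rho>"]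
    by (auto simp: mult_ac power2_commute)
qed simp

text \<open>
  Borel-Caratheodory for a logarithm \<open>\<phi>\<close> of \<open>g\<close>. The hypothesis says that \<open>Re (\<phi> - \<phi> c) < A\<close>, and
  \<open>\<psi> \<mapsto> \<psi> / (2 A - \<psi>)\<close> maps this half plane to the unit disc. The Schwarz lemma then bounds
  \<open>\<phi> - \<phi> c\<close> by \<open>2 A\<close> on the disc of half the radius, and Cauchy's inequality bounds its second derivative.
\<close>
lemma deriv_logderiv_bound:
  assumes g: "g holomorphic_on ball c R" and R: "R > 0" and nz: "\<And>z. z \<in> ball c R \<Longrightarrow> g z \<noteq> 0"
    and A: "A > 0" and bd: "\<And>z. z \<in> ball c R \<Longrightarrow> norm (g z) < norm (g c) * exp A"
  shows "norm (deriv_logderiv g c) \<le> 16 * A / R\<^sup>2"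
proof -
  obtain \<phi> where \<phi>: "\<phi> holomorphic_on ball c R" "\<And>z. z \<in> ball c R \<Longrightarrow> g z = exp (\<phi> z)"
    using contractible_imp_holomorphic_log[OF g convex_imp_contractible[OF convex_ball] nz] by blast
  have cin: "c \<in> ball c R" using R by simp
  define \<psi> where "\<psi> = (\<lambda>w. \<phi> (c + of_real R * w) - \<phi> c)"
  have inb: "c + of_real R * w \<in> ball c R" if "norm w < 1" for w
    using that R by (simp add: dist_norm norm_mult)
  have hol\<psi>: "\<psi> holomorphic_on ball 0 1"
    unfolding \<psi>_def
    by (intro holomorphic_intros holomorphic_on_compose_gen[OF _ \<phi>(1), unfolded o_def]) (auto intro: inb)
  have Re\<psi>: "Re (\<psi> w) < A" if "norm w < 1" for w
  proof -
    have "exp (Re (\<phi> (c + of_real R * w))) < exp (Re (\<phi> c)) * exp A"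
      using bd[OF inb[OF that]] \<phi>(2)[OF inb[OF that]] \<phi>(2)[OF cin] by (simp add: norm_exp_eq_Re)
    then show ?thesis by (simp add: \<psi>_def flip: exp_add)
  qed
  define \<omega> where "\<omega> = (\<lambda>w. \<psi> w / (2 * A - \<psi> w))"
  have ne: "2 * A - \<psi> w \<noteq> 0" if "norm w < 1" for w
  proof
    assume "2 * A - \<psi> w = 0"
    then have "Re (\<psi> w) = 2 * A" by (simp add: complex_eq_iff)
    with Re\<psi>[OF that] A show False by simp
  qed
  have \<omega>lt: "norm (\<omega> w) < 1" if "norm w < 1" for w
  proof -
    have "(norm (\<psi> w))\<^sup>2 < (norm (2 * A - \<psi> w))\<^sup>2"
    proof -
      have "(2 * A - Re (\<psi> w))\<^sup>2 - (Re (\<psi> w))\<^sup>2 = 4 * A * (A - Re (\<psi> w))"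
        by (simp add: power2_eq_square algebra_simps)
      also have "\<dots> > 0" using Re\<psi>[OF that] A by simp
      finally show ?thesis by (simp add: cmod_power2)
    qed
    then have "norm (\<psi> w) < norm (2 * A - \<psi> w)" by (rule power2_less_imp_less) simp
    then show ?thesis using ne[OF that] by (simp add: \<omega>_def norm_divide)
  qed
  have hol\<omega>: "\<omega> holomorphic_on ball 0 1"
    unfolding \<omega>_def using ne by (intro holomorphic_intros hol\<psi>) auto
  have \<psi>bd: "norm (\<psi> w) \<le> 2 * A" if "norm w \<le> 1/2" for w
  proof -
    have w1: "norm w < 1" using that by simp
    have "norm (\<omega> w) \<le> norm w"
      using Schwarz_Lemma(1)[OF hol\<omega> _ \<omega>lt w1] by (simp add: \<omega>_def \<psi>_def)
    then have w2: "norm (\<omega> w) \<le> 1/2" using that by simp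
    have "\<psi> w = \<omega> w * (2 * A - \<psi> w)" using ne[OF w1] by (simp add: \<omega>_def)
    then have "norm (\<psi> w) \<le> 1/2 * norm (2 * A - \<psi> w)"
      using w2 by (metis mult_right_mono norm_ge_zero norm_mult)
    also have "\<dots> \<le> 1/2 * (2 * A + norm (\<psi> w))"
      using A norm_triangle_ineq4[of "2 * complex_of_real A" "\<psi> w"] by (simp add: norm_mult)
    finally show ?thesis by simp
  qed
  have "norm ((deriv ^^ 2) \<psi> 0) \<le> fact 2 * (2 * A) / (1/2) ^ 2"
  proof (rule Cauchy_inequality)
    show "\<psi> holomorphic_on ball 0 (1/2)" using hol\<psi> by (rule holomorphic_on_subset) auto
    show "continuous_on (cball 0 (1/2)) \<psi>"
      by (rule continuous_on_subset[OF holomorphic_on_imp_continuous_on[OF hol\<psi>]]) auto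
  qed (use \<psi>bd in auto)
  then have D2: "norm (deriv (deriv \<psi>) 0) \<le> 16 * A" by (simp add: numeral_2_eq_2)
  have affine: "((\<lambda>w. c + of_real R * w) has_field_derivative of_real R) (at w)" for w
    by (auto intro!: derivative_eq_intros)
  have d1: "deriv \<psi> w = of_real R * deriv \<phi> (c + of_real R * w)" if "norm w < 1" for w
    unfolding \<psi>_def
    using DERIV_chain2[OF holomorphic_derivI[OF \<phi>(1) open_ball inb[OF that]] affine]
    by (intro DERIV_imp_deriv) (auto intro!: derivative_eq_intros simp: mult.commute)
  have d2: "deriv (deriv \<psi>) 0 = of_real R * (of_real R * deriv (deriv \<phi>) c)"
  proof -
    have "deriv (deriv \<psi>) 0 = deriv (\<lambda>w. of_real R * deriv \<phi> (c + of_real R * w)) 0"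
      by (intro deriv_cong_ev) (auto intro!: eventually_nhds_in_open[of "ball 0 1", THEN eventually_mono] d1)
    also have "\<dots> = of_real R * (of_real R * deriv (deriv \<phi>) c)"
      using DERIV_chain2[OF holomorphic_derivI[OF holomorphic_deriv[OF \<phi>(1) open_ball] open_ball]
              affine, of 0] R
      by (intro DERIV_imp_deriv DERIV_cmult) (auto simp: mult.commute)
    finally show ?thesis .
  qed
  have "deriv_logderiv g c = deriv (deriv \<phi>) c"
    unfolding deriv_logderiv_def
  proof (rule deriv_cong_ev)
    have "\<forall>\<^sub>F z in nhds c. z \<in> ball c R" using R by (intro eventually_nhds_in_open) auto
    then show "\<forall>\<^sub>F z in nhds c. deriv g z / g z = deriv \<phi> z"
    proof eventually_elim
      case (elim z)
      have "deriv g z = deriv (\<lambda>z. exp (\<phi> z)) z"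
        using elim \<phi>(2) by (intro deriv_cong_ev) (auto intro!: eventually_nhds_in_open[of "ball c R", THEN eventually_mono])
      also have "\<dots> = exp (\<phi> z) * deriv \<phi> z"
        using holomorphic_derivI[OF \<phi>(1) open_ball elim]
        by (intro DERIV_imp_deriv) (auto intro!: derivative_eq_intros)
      finally show ?case using \<phi>(2)[OF elim] by simp
    qed
  qed simp
  then have "R\<^sup>2 * norm (deriv_logderiv g c) \<le> 16 * A"
    using D2 R by (simp add: d2 norm_mult power2_eq_square)
  then show ?thesis using R by (simp add: field_simps)
qed

text \<open>
  Divide \<open>h\<close> by its zeros in the disc of radius \<open>R\<close>. On the circle of radius \<open>2 R\<close> every factor
  \<open>z - \<rho>\<close> is at least as large as \<open>c - \<rho>\<close>, so the quotient inherits the bound for \<open>h\<close> relative to its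
  value at \<open>c\<close>, and by the maximum principle it does so inside the circle as well.
\<close>
lemma deriv_logderiv_zeros_sum_bound:
  fixes R :: real
  assumes h: "h holomorphic_on UNIV" and nz: "h c \<noteq> 0" and R: "R > 0"
    and bd: "\<And>z. dist c z = 2 * R \<Longrightarrow> norm (h z) < norm (h c) * exp A" and A: "A > 0"
  shows "finite {\<rho>. h \<rho> = 0 \<and> dist c \<rho> \<le> R}" and
   "norm (deriv_logderiv h c + (\<Sum>\<rho> | h \<rho> = 0 \<and> dist c \<rho> \<le> R. of_int (zorder h \<rho>) / (\<rho> - c)\<^sup>2))
            \<le> 16 * A / R\<^sup>2"
proof -
  define Z where "Z = {\<rho>. h \<rho> = 0 \<and> dist c \<rho> \<le> R}"
  have "Z = {z \<in> cball c R. h z = 0}" by (auto simp: Z_def)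
  moreover have "finite {z \<in> cball c R. h z = 0}"
  proof (cases "h constant_on UNIV")
    case True
    then have "h z \<noteq> 0" for z using nz unfolding constant_on_def by (metis UNIV_I)
    then show ?thesis by simp
  next
    case False
    then show ?thesis
      by (intro holomorphic_compact_finite_zeros[OF h]) auto
  qed
  ultimately have fin: "finite Z" by simp
  then show "finite {\<rho>. h \<rho> = 0 \<and> dist c \<rho> \<le> R}" by (simp add: Z_def)
  obtain g m where g: "g holomorphic_on UNIV" "\<And>z. h z = g z * (\<Prod>\<rho>\<in>Z. (z - \<rho>) ^ m \<rho>)"
    "\<And>\<rho>. \<rho> \<in> Z \<Longrightarrow> g \<rho> \<noteq> 0" "\<And>\<rho>. \<rho> \<in> Z \<Longrightarrow> zorder h \<rho> = int (m \<rho>)"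
    using entire_split_zeros[OF h nz fin] by blast
  have cZ: "c \<notin> Z" using nz by (auto simp: Z_def)
  have gc: "g c \<noteq> 0" using nz g(2)[of c] by auto
  have hd: "deriv_logderiv h c = deriv_logderiv g c - (\<Sum>\<rho>\<in>Z. of_nat (m \<rho>) / (\<rho> - c)\<^sup>2)"
    using deriv_logderiv_split_zeros[OF g(1) gc fin cZ, of m] g(2) by presburger
  have gb: "norm (g z) < norm (g c) * exp A" if z: "dist c z = 2 * R" for z
  proof -
    let ?P = "\<lambda>z. (\<Prod>\<rho>\<in>Z. (z - \<rho>) ^ m \<rho>)"
    have le: "norm (?P c) \<le> norm (?P z)"
      unfolding prod_norm[symmetric] norm_power
    proof (intro prod_mono conjI power_mono)
      fix \<rho> assume "\<rho> \<in> Z"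
      then have "dist c \<rho> \<le> R" by (simp add: Z_def)
      then show "norm (c - \<rho>) \<le> norm (z - \<rho>)"
        using z dist_triangle[of c z \<rho>] by (simp add: dist_norm norm_minus_commute)
    qed auto
    have Pc: "norm (?P c) > 0" using nz g(2)[of c] by auto
    have "norm (g z) * norm (?P c) \<le> norm (g z) * norm (?P z)"
      by (intro mult_left_mono le) auto
    also have "\<dots> = norm (h z)" by (simp add: g(2) norm_mult)
    also have "\<dots> < norm (h c) * exp A" by (rule bd[OF z])
    also have "\<dots> = norm (g c) * exp A * norm (?P c)" by (simp add: g(2)[of c] norm_mult)
    finally show ?thesis using Pc by simp
  qed
  have gb': "norm (g z) < norm (g c) * exp A" if z: "z \<in> ball c R" for z
  proof -
    have cont: "continuous_on (cball c (2*R)) g"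
      using g(1) holomorphic_on_imp_continuous_on continuous_on_subset by blast
    obtain w where w: "w \<in> sphere c (2*R)" "\<And>y. y \<in> sphere c (2*R) \<Longrightarrow> norm (g y) \<le> norm (g w)"
    proof -
      have ne: "sphere c (2*R) \<noteq> {}" using R by simp
      have "continuous_on (sphere c (2*R)) (\<lambda>y. norm (g y))"
        by (intro continuous_intros continuous_on_subset[OF cont]) auto
      from continuous_attains_sup[OF compact_sphere ne this] that show ?thesis by blast
    qed
    have "norm (g z) \<le> norm (g w)"
    proof (rule maximum_modulus_frontier[of g "ball c (2*R)"])
      show "g holomorphic_on interior (ball c (2 * R))" using g(1) holomorphic_on_subset by blast
      show "continuous_on (closure (ball c (2 * R))) g" using R cont by simp
      show "norm (g y) \<le> norm (g w)" if "y \<in> frontier (ball c (2 * R))" for y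
        using that w(2) R by simp
      show "z \<in> ball c (2*R)" using z R by simp
    qed auto
    also have "\<dots> < norm (g c) * exp A" using w(1) by (intro gb) auto
    finally show ?thesis .
  qed
  have "norm (deriv_logderiv g c) \<le> 16 * A / R\<^sup>2"
  proof (rule deriv_logderiv_bound)
    show "g holomorphic_on ball c R" using g(1) holomorphic_on_subset by blast
    show "g z \<noteq> 0" if "z \<in> ball c R" for z
    proof
      assume "g z = 0"
      then have "z \<in> Z" using that g(2)[of z] by (auto simp: Z_def)
      then show False using g(3) \<open>g z = 0\<close> by blast
    qed
  qed (use R A gb' in auto)
  moreover have "(\<Sum>\<rho>\<in>Z. of_int (zorder h \<rho>) / (\<rho> - c)\<^sup>2) = (\<Sum>\<rho>\<in>Z. of_nat (m \<rho>) / (\<rho> - c)\<^sup>2)"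
    using g(4) by (intro sum.cong) auto
  ultimately show "norm (deriv_logderiv h c + (\<Sum>\<rho> | h \<rho> = 0 \<and> dist c \<rho> \<le> R. of_int (zorder h \<rho>) / (\<rho> - c)\<^sup>2))
            \<le> 16 * A / R\<^sup>2"
    by (simp add: hd Z_def)
qed


text \<open>
  For order \<open>q < 2\<close> the error term of the finite sums is \<open>O(R\<^sup>q / R\<^sup>2)\<close>. This gives convergence only along
  the discs; unconditional convergence follows because all terms are nonnegative when the zeros
  and \<open>c\<close> are real.
\<close>
lemma has_sum_zeros_deriv_logderiv:
  fixes c :: real
  assumes h: "h holomorphic_on UNIV" and nz: "h c \<noteq> 0"
    and growth: "\<And>z. norm (h z) \<le> B * exp (K * (1 + norm z) powr q)" and q: "0 \<le> q" "q < 2"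
    and real: "\<And>z. h z = 0 \<Longrightarrow> z \<in> \<real>"
  shows "((\<lambda>\<rho>. of_int (zorder h \<rho>) / (\<rho> - of_real c)\<^sup>2) has_sum (- deriv_logderiv h c)) {\<rho>. h \<rho> = 0}"
proof -
  define t :: "complex \<Rightarrow> complex" where "t = (\<lambda>\<rho>. of_int (zorder h \<rho>) / (\<rho> - of_real c)\<^sup>2)"
  define Z where "Z = (\<lambda>R. {\<rho>. h \<rho> = 0 \<and> dist (of_real c) \<rho> \<le> R})"
  \<comment> \<open>A nonnegative substitute for \<open>K\<close> makes the bound monotone in \<open>norm z\<close>.\<close>
  define K' where "K' = max K 0"
  define L where "L = ln (max 1 (B / norm (h c))) + 1"
  define A where "A = (\<lambda>R. K' * (1 + norm c + 2 * R) powr q + L)"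
  have L: "L > 0" "B < norm (h c) * exp L"
  proof -
    have "ln (max 1 (B / norm (h c))) \<ge> 0" by simp
    then show "L > 0" unfolding L_def by linarith
    have "B / norm (h c) \<le> max 1 (B / norm (h c))" by simp
    also have "\<dots> < max 1 (B / norm (h c)) * exp 1"
      using mult_strict_left_mono[of 1 "exp (1::real)" "max 1 (B / norm (h c))"] by simp
    also have "\<dots> = exp L" by (simp add: L_def exp_add)
    finally show "B < norm (h c) * exp L" using nz by (simp add: field_simps)
  qed
  have B: "B > 0"
  proof -
    have "0 < norm (h c)" using nz by simp
    also have "\<dots> \<le> B * exp (K * (1 + norm (complex_of_real c)) powr q)" by (rule growth)
    finally show ?thesis by (simp add: zero_less_mult_iff)
  qed
  have A: "A R > 0" if "R > 0" for R
    unfolding A_def using L(1) by (intro add_nonneg_pos mult_nonneg_nonneg) (auto simp: K'_def)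
  have bd: "norm (h z) < norm (h c) * exp (A R)" if "dist (of_real c) z = 2 * R" "R > 0" for z R
  proof -
    have zR: "norm z \<le> norm c + 2 * R"
      using that norm_triangle_sub[of z "of_real c"] by (simp add: dist_norm norm_minus_commute)
    have "K * (1 + norm z) powr q \<le> K' * (1 + norm c + 2 * R) powr q"
    proof -
      have "K * (1 + norm z) powr q \<le> K' * (1 + norm z) powr q"
        by (intro mult_right_mono) (auto simp: K'_def)
      also have "\<dots> \<le> K' * (1 + norm c + 2 * R) powr q"
        using zR q by (intro mult_left_mono powr_mono2) (auto simp: K'_def)
      finally show ?thesis .
    qed
    then have "norm (h z) \<le> B * exp (K' * (1 + norm c + 2 * R) powr q)"
      using growth[of z] B by (meson dual_order.trans exp_le_cancel_iff mult_le_cancel_left_pos)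
    also have "\<dots> < (norm (h c) * exp L) * exp (K' * (1 + norm c + 2 * R) powr q)"
      using L(2) by simp
    also have "\<dots> = norm (h c) * exp (A R)" by (simp add: A_def exp_add)
    finally show ?thesis .
  qed
  have fin: "finite (Z R)" and
    sum_bound: "norm (deriv_logderiv h c + sum t (Z R)) \<le> 16 * A R / R\<^sup>2" if "R > 0" for R
    using deriv_logderiv_zeros_sum_bound[OF h nz that bd[OF _ that] A[OF that]]
    by (simp_all add: Z_def t_def)
  have lim0: "((\<lambda>R. 16 * A R / R\<^sup>2) \<longlongrightarrow> 0) at_top"
  proof -
    have "((\<lambda>R. (1 + norm c + 2 * R) powr q / R\<^sup>2) \<longlongrightarrow> 0) at_top"
      using q by real_asymp
    moreover have "((\<lambda>R. L / R\<^sup>2) \<longlongrightarrow> 0) at_top"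
      by real_asymp
    ultimately have "((\<lambda>R. 16 * (K' * ((1 + norm c + 2 * R) powr q / R\<^sup>2) + L / R\<^sup>2)) \<longlongrightarrow> 16 * (K' * 0 + 0)) at_top"
      by (intro tendsto_intros)
    then show ?thesis by (simp add: A_def add_divide_distrib)
  qed
  have "((\<lambda>R. deriv_logderiv h c + sum t (Z R)) \<longlongrightarrow> 0) at_top"
    by (rule Lim_null_comparison[OF _ lim0], rule eventually_mono[OF eventually_gt_at_top[of 0]])
       (use sum_bound in auto)
  from tendsto_diff[OF this tendsto_const[of "deriv_logderiv h c"]]
  have lim: "((\<lambda>R. sum t (Z R)) \<longlongrightarrow> - deriv_logderiv h c) at_top" by simp
  define s where "s = (\<lambda>\<rho>. real_of_int (zorder h \<rho>) / (Re \<rho> - c)\<^sup>2)"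
  have ts: "t \<rho> = of_real (s \<rho>)" if "h \<rho> = 0" for \<rho>
    using real[OF that] by (auto simp: t_def s_def elim!: Reals_cases)
  have s_nonneg: "s \<rho> \<ge> 0" if "h \<rho> = 0" for \<rho>
  proof -
    have "zorder h \<rho> \<ge> 0"
    proof (rule entire_split_zeros[OF h nz, of "{\<rho>}"])
      fix m :: "complex \<Rightarrow> nat"
      assume "\<And>\<rho>'. \<rho>' \<in> {\<rho>} \<Longrightarrow> zorder h \<rho>' = int (m \<rho>')"
      then show ?thesis by simp
    qed simp
    then show ?thesis by (simp add: s_def)
  qed
  have lims: "((\<lambda>R. sum s (Z R)) \<longlongrightarrow> Re (- deriv_logderiv h c)) at_top"
  proof -
    have "Re (sum t (Z R)) = sum s (Z R)" for R
      by (auto simp: Z_def ts intro!: sum.cong)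
    then show ?thesis using tendsto_Re[OF lim] by simp
  qed
  have Im: "Im (- deriv_logderiv h c) = 0"
  proof -
    have "Im (sum t (Z R)) = 0" for R
      by (auto simp: Z_def ts intro!: sum.neutral)
    then show ?thesis using tendsto_Im[OF lim] by (simp add: tendsto_const_iff)
  qed
  have sum_le: "sum s F \<le> Re (- deriv_logderiv h c)" if F: "finite F" "F \<subseteq> {\<rho>. h \<rho> = 0}" for F
  proof (rule tendsto_lowerbound[OF lims])
    have "\<forall>\<^sub>F R in at_top. \<forall>\<rho>\<in>F. dist (of_real c) \<rho> \<le> R"
      using F(1) by (intro eventually_ball_finite) (auto intro: eventually_ge_at_top)
    then show "\<forall>\<^sub>F R in at_top. sum s F \<le> sum s (Z R)"
      using eventually_gt_at_top[of 0]
    proof eventually_elim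
      case (elim R)
      show ?case using F elim by (intro sum_mono2 fin s_nonneg) (auto simp: Z_def)
    qed
  qed simp
  have summ: "s summable_on {\<rho>. h \<rho> = 0}"
    by (rule nonneg_bdd_above_summable_on)
       (use sum_le in \<open>auto intro!: s_nonneg bdd_aboveI2[where M = "Re (- deriv_logderiv h c)"]\<close>)
  have "infsum s {\<rho>. h \<rho> = 0} = Re (- deriv_logderiv h c)"
  proof (rule antisym)
    show "infsum s {\<rho>. h \<rho> = 0} \<le> Re (- deriv_logderiv h c)"
      by (rule infsum_le_finite_sums[OF summ]) (rule sum_le)
    show "Re (- deriv_logderiv h c) \<le> infsum s {\<rho>. h \<rho> = 0}"
    proof (rule tendsto_upperbound[OF lims])
      show "\<forall>\<^sub>F R in at_top. sum s (Z R) \<le> infsum s {\<rho>. h \<rho> = 0}"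
        using eventually_gt_at_top[of 0]
      proof eventually_elim
        case (elim R)
        show ?case by (rule finite_sum_le_infsum[OF summ fin[OF elim]]) (auto simp: Z_def s_nonneg)
      qed
    qed simp
  qed
  then have "(s has_sum Re (- deriv_logderiv h c)) {\<rho>. h \<rho> = 0}"
    using summ has_sum_infsum by metis
  then have "((\<lambda>\<rho>. complex_of_real (s \<rho>)) has_sum of_real (Re (- deriv_logderiv h c))) {\<rho>. h \<rho> = 0}"
    by (rule has_sum_of_real)
  moreover have "((\<lambda>\<rho>. complex_of_real (s \<rho>)) has_sum X) {\<rho>. h \<rho> = 0} \<longleftrightarrow> (t has_sum X) {\<rho>. h \<rho> = 0}" for X
    by (rule has_sum_cong) (simp add: ts)
  moreover have "complex_of_real (Re (- deriv_logderiv h c)) = - deriv_logderiv h c"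
    using Im by (simp add: complex_eq_iff)
  ultimately have "(t has_sum (- deriv_logderiv h c)) {\<rho>. h \<rho> = 0}" by simp
  then show ?thesis by (simp add: t_def)
qed

section \<open>Strong Lehmer pairs\<close>

lemma deriv_real_on_reals:
  assumes f: "f field_differentiable at (complex_of_real x)" and real: "\<And>t::real. f (of_real t) \<in> \<real>"
  shows "deriv f (of_real x) \<in> \<real>"
proof -
  have "(f has_field_derivative deriv f (of_real x)) (at (of_real x))"
    using f by (simp add: DERIV_deriv_iff_field_differentiable)
  then have "((\<lambda>z. (f z - f (of_real x)) / (z - of_real x)) \<longlongrightarrow> deriv f (of_real x)) (at (of_real x))"
    by (simp add: has_field_derivative_iff)
  moreover have "filterlim complex_of_real (at (complex_of_real x)) (at x)"
    unfolding filterlim_at by (auto simp: eventually_at_filter intro!: tendsto_intros)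
  ultimately have "((\<lambda>t. (f (of_real t) - f (of_real x)) / (of_real t - of_real x)) \<longlongrightarrow> deriv f (of_real x)) (at x)"
    by (rule filterlim_compose)
  then show ?thesis
    by (rule Lim_in_closed_set[OF closed_complex_Reals, rotated 2]) (auto intro!: always_eventually Reals_divide Reals_diff real)
qed

text \<open>
  With \<open>f = (z - a) h\<close> one has \<open>f' = h\<close>, \<open>f'' = 2 h'\<close> and \<open>f''' = 3 h''\<close> at \<open>a\<close>, so the left-hand side is
  \<open>3 h''/h - 4 (h'/h)\<^sup>2\<close>, while \<open>(h'/h)' = h''/h - (h'/h)\<^sup>2\<close>.
\<close>
lemma deriv_pre_schwarzian_at_simple_zero:
  assumes h: "h holomorphic_on UNIV" and f: "\<And>z. f z = (z - a) * h z" and ha: "h a \<noteq> 0"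
  shows "deriv (pre_schwarzian f) a = 3 * deriv_logderiv h a - (deriv (deriv f) a / (2 * deriv f a))\<^sup>2"
proof -
  have D: "(g has_field_derivative deriv g z) (at z)" if "g holomorphic_on UNIV" for g z
    using that by (auto intro: holomorphic_derivI)
  have h': "deriv h holomorphic_on UNIV" and h'': "deriv (deriv h) holomorphic_on UNIV"
    using h by (auto intro!: holomorphic_deriv)
  note Dh = D[OF h] D[OF h'] D[OF h'']
  have f1: "deriv f = (\<lambda>z. h z + (z - a) * deriv h z)"
    unfolding f[abs_def] by (intro ext DERIV_imp_deriv) (auto intro!: derivative_eq_intros Dh)
  have f2: "deriv (deriv f) = (\<lambda>z. 2 * deriv h z + (z - a) * deriv (deriv h) z)"
    unfolding f1 by (intro ext DERIV_imp_deriv) (auto intro!: derivative_eq_intros Dh)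
  have f3: "((\<lambda>z. 2 * deriv h z + (z - a) * deriv (deriv h) z) has_field_derivative 3 * deriv (deriv h) a) (at a)"
    by (auto intro!: derivative_eq_intros Dh)
  have f2': "((\<lambda>z. h z + (z - a) * deriv h z) has_field_derivative 2 * deriv h a) (at a)"
    by (auto intro!: derivative_eq_intros Dh)
  have P: "deriv (pre_schwarzian f) a = (3 * deriv (deriv h) a * h a - 2 * deriv h a * (2 * deriv h a)) / (h a * h a)"
    unfolding pre_schwarzian_def[abs_def] f2 unfolding f1
    by (rule DERIV_imp_deriv, rule DERIV_cong, rule DERIV_divide[OF f3 f2']) (use ha in auto)
  have L: "deriv_logderiv h a = (deriv (deriv h) a * h a - deriv h a * deriv h a) / (h a * h a)"
    unfolding deriv_logderiv_def by (rule DERIV_imp_deriv, rule DERIV_divide[OF Dh(2) Dh(1) ha])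
  have Q: "deriv (deriv f) a / (2 * deriv f a) = deriv h a / h a"
    unfolding f2 unfolding f1 by simp
  show ?thesis
    unfolding P L Q using ha by (simp add: field_simps power2_eq_square)
qed

text \<open>
  The summation formula for \<open>h = \<Xi> / (z - a)\<close>, which has the same growth and the same other zeros as
  \<open>\<Xi>\<close>; the inequality comes from discarding the square of a real number.
\<close>
lemma riemann_Xi_simple_zero:
  fixes a :: real
  assumes RH: Riemann_Hypothesis and zero: "riemann_Xi (of_real a) = 0" and simple: "zorder riemann_Xi (of_real a) = 1"
  obtains S where
    "((\<lambda>\<rho>. of_int (zorder riemann_Xi \<rho>) / (\<rho> - of_real a)\<^sup>2) has_sum S) ({\<rho>. riemann_Xi \<rho> = 0} - {of_real a})"
    "3 * Re S \<le> Re (- deriv (pre_schwarzian riemann_Xi) (of_real a))"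
proof -
  have hol: "riemann_Xi holomorphic_on UNIV" by (rule riemann_Xi_holomorphic)
  \<comment> \<open>By the Riemann Hypothesis \<open>\<i>\<close> is not a zero, so \<open>\<Xi>\<close> does not vanish identically.\<close>
  have "\<i> \<notin> \<real>" by (simp add: complex_is_Real_iff)
  then have nz: "riemann_Xi \<i> \<noteq> 0" using RH by (auto simp: Riemann_Hypothesis_def)
  obtain h m where h: "h holomorphic_on UNIV" "\<And>z. riemann_Xi z = h z * (\<Prod>\<rho>\<in>{complex_of_real a}. (z - \<rho>) ^ m \<rho>)"
    "\<And>\<rho>. \<rho> \<in> {complex_of_real a} \<Longrightarrow> h \<rho> \<noteq> 0" "\<And>\<rho>. \<rho> \<in> {complex_of_real a} \<Longrightarrow> zorder riemann_Xi \<rho> = int (m \<rho>)"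
    using entire_split_zeros[OF hol nz, of "{complex_of_real a}"] by blast
  have ha: "h a \<noteq> 0" using h(3) by simp
  have fh: "riemann_Xi z = (z - of_real a) * h z" for z
    using h(2)[of z] h(4)[of a] simple by simp
  have zeros: "{\<rho>. h \<rho> = 0} = {\<rho>. riemann_Xi \<rho> = 0} - {of_real a}"
    using ha by (auto simp: fh)
  have ord: "zorder h \<rho> = zorder riemann_Xi \<rho>" if "\<rho> \<noteq> of_real a" for \<rho>
  proof -
    obtain g k where g: "g holomorphic_on UNIV" "\<And>z. h z = g z * (\<Prod>\<rho>\<in>{\<rho>}. (z - \<rho>) ^ k \<rho>)"
      "\<And>\<rho>'. \<rho>' \<in> {\<rho>} \<Longrightarrow> g \<rho>' \<noteq> 0" "\<And>\<rho>'. \<rho>' \<in> {\<rho>} \<Longrightarrow> zorder h \<rho>' = int (k \<rho>')"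
      using entire_split_zeros[OF h(1) ha, of "{\<rho>}"] by blast
    have "zorder riemann_Xi \<rho> = int (k \<rho>)"
    proof (rule zorder_eqI)
      show "(\<lambda>z. (z - of_real a) * g z) holomorphic_on UNIV" by (intro holomorphic_intros g(1))
      show "riemann_Xi w = ((w - of_real a) * g w) * (w - \<rho>) powi int (k \<rho>)" for w
        using g(2)[of w] by (simp add: fh)
    qed (use that g(3) in auto)
    then show ?thesis using g(4) by simp
  qed
  obtain B where B: "\<And>z. norm (riemann_Xi z) \<le> B * exp (3 * (1 + norm z) powr (3/2))"
    using riemann_Xi_bound by blast
  obtain M where M: "\<And>z. z \<in> cball (of_real a) 1 \<Longrightarrow> norm (h z) \<le> M"
  proof -
    have "compact (h ` cball (of_real a) 1)"
      by (intro compact_continuous_image compact_cball holomorphic_on_imp_continuous_on holomorphic_on_subset[OF h(1)]) auto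
    then obtain M where "\<forall>y\<in>h ` cball (of_real a) 1. norm y \<le> M"
      using compact_imp_bounded bounded_iff by metis
    then show thesis by (intro that[of M]) auto
  qed
  have growth: "norm (h z) \<le> max B M * exp (3 * (1 + norm z) powr (3/2))" for z
  proof (cases "z \<in> cball (of_real a) 1")
    case True
    have "0 \<le> norm (h z)" by simp
    also have "\<dots> \<le> M" by (rule M[OF True])
    finally have "M * 1 \<le> max B M * exp (3 * (1 + norm z) powr (3/2))" by (intro mult_mono) auto
    then show ?thesis using M[OF True] by linarith
  next
    case False
    then have "norm (z - of_real a) \<ge> 1" by (simp add: dist_norm norm_minus_commute)
    then have "norm (h z) \<le> norm (z - of_real a) * norm (h z)" by (simp add: mult_le_cancel_right1)
    also have "\<dots> = norm (riemann_Xi z)" by (simp add: fh norm_mult)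
    also have "\<dots> \<le> B * exp (3 * (1 + norm z) powr (3/2))" by (rule B)
    also have "\<dots> \<le> max B M * exp (3 * (1 + norm z) powr (3/2))" by (intro mult_right_mono) auto
    finally show ?thesis .
  qed
  have real: "z \<in> \<real>" if "h z = 0" for z
    using that RH fh[of z] by (auto simp: Riemann_Hypothesis_def)
  have sum: "((\<lambda>\<rho>. of_int (zorder h \<rho>) / (\<rho> - of_real a)\<^sup>2) has_sum (- deriv_logderiv h a)) {\<rho>. h \<rho> = 0}"
    by (rule has_sum_zeros_deriv_logderiv[OF h(1) ha growth _ _ real]) auto
  have "((\<lambda>\<rho>. of_int (zorder riemann_Xi \<rho>) / (\<rho> - of_real a)\<^sup>2) has_sum (- deriv_logderiv h a)) ({\<rho>. riemann_Xi \<rho> = 0} - {of_real a})"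
    unfolding zeros[symmetric]
  proof (rule has_sum_cong[THEN iffD1, OF _ sum])
    fix \<rho> assume "\<rho> \<in> {\<rho>. h \<rho> = 0}"
    then have "\<rho> \<noteq> of_real a" using ha by auto
    then show "of_int (zorder h \<rho>) / (\<rho> - of_real a)\<^sup>2 = of_int (zorder riemann_Xi \<rho>) / (\<rho> - of_real a)\<^sup>2"
      by (simp add: ord)
  qed
  moreover have "3 * Re (- deriv_logderiv h a) \<le> Re (- deriv (pre_schwarzian riemann_Xi) (of_real a))"
  proof -
    define L where "L = deriv (deriv riemann_Xi) a / (2 * deriv riemann_Xi a)"
    have diff: "riemann_Xi field_differentiable at z" "deriv riemann_Xi field_differentiable at z" for z
      using hol holomorphic_deriv[OF hol] by (auto simp: holomorphic_on_open field_differentiable_def intro: holomorphic_derivI)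
    have d1: "deriv riemann_Xi (of_real t) \<in> \<real>" for t
      by (rule deriv_real_on_reals[OF diff(1)]) (rule riemann_Xi_real)
    have d2: "deriv (deriv riemann_Xi) (of_real t) \<in> \<real>" for t
      by (rule deriv_real_on_reals[OF diff(2)]) (rule d1)
    have "L \<in> \<real>" unfolding L_def by (intro Reals_divide Reals_mult d1 d2) auto
    then have "Re (L\<^sup>2) \<ge> 0" by (auto elim!: Reals_cases simp flip: of_real_power)
    then show ?thesis
      using deriv_pre_schwarzian_at_simple_zero[OF h(1) fh ha] by (simp add: L_def)
  qed
  ultimately show thesis by (rule that)
qed

theorem theorem1:
  fixes \<gamma>m \<gamma>p :: real
  assumes "Riemann_Hypothesis"
    and "0 < \<gamma>m" and "\<gamma>m < \<gamma>p"
    and "riemann_Xi (of_real \<gamma>m) = 0" and "riemann_Xi (of_real \<gamma>p) = 0"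
    and "zorder riemann_Xi (of_real \<gamma>m) = 1" and "zorder riemann_Xi (of_real \<gamma>p) = 1"
    and "\<forall>t::real. \<gamma>m < t \<and> t < \<gamma>p \<longrightarrow> riemann_Xi (of_real t) \<noteq> 0"
    and "strong_lehmer_pair \<gamma>m \<gamma>p"
  shows "lehmer_pair \<gamma>m \<gamma>p"
proof -
  let ?N = "{\<rho>. riemann_Xi \<rho> = 0}"
  let ?m = "complex_of_real \<gamma>m" and ?p = "complex_of_real \<gamma>p"
  let ?t = "\<lambda>a \<rho>. of_int (zorder riemann_Xi \<rho>) / (\<rho> - complex_of_real a)\<^sup>2"
  define \<Delta> where "\<Delta> = \<gamma>p - \<gamma>m"
  have \<Delta>: "\<Delta> > 0" using assms by (simp add: \<Delta>_def)
  obtain Sm where Sm: "(?t \<gamma>m has_sum Sm) (?N - {?m})"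
    "3 * Re Sm \<le> Re (- deriv (pre_schwarzian riemann_Xi) ?m)"
    using riemann_Xi_simple_zero assms by blast
  obtain Sp where Sp: "(?t \<gamma>p has_sum Sp) (?N - {?p})"
    "3 * Re Sp \<le> Re (- deriv (pre_schwarzian riemann_Xi) ?p)"
    using riemann_Xi_simple_zero assms by blast
  \<comment> \<open>Each sum loses the other member of the pair, a simple zero at distance \<open>\<Delta>\<close>.\<close>
  have "(?t \<gamma>m has_sum (Sm - ?t \<gamma>m ?p)) (?N - {?m} - {?p})"
    by (rule has_sum_Diff[OF Sm(1)]) (use assms in \<open>auto intro: has_sum_finiteI\<close>)
  moreover have "(?t \<gamma>p has_sum (Sp - ?t \<gamma>p ?m)) (?N - {?p} - {?m})"
    by (rule has_sum_Diff[OF Sp(1)]) (use assms in \<open>auto intro: has_sum_finiteI\<close>)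
  moreover have "?N - {?m} - {?p} = other_zeros \<gamma>m \<gamma>p" "?N - {?p} - {?m} = other_zeros \<gamma>m \<gamma>p"
    by (auto simp: other_zeros_def)
  moreover have "?t \<gamma>m ?p = of_real (1 / \<Delta>\<^sup>2)" "?t \<gamma>p ?m = of_real (1 / \<Delta>\<^sup>2)"
    using assms by (simp_all add: \<Delta>_def power2_commute)
  ultimately have "((\<lambda>\<rho>. ?t \<gamma>m \<rho> + ?t \<gamma>p \<rho>) has_sum ((Sm - of_real (1 / \<Delta>\<^sup>2)) + (Sp - of_real (1 / \<Delta>\<^sup>2)))) (other_zeros \<gamma>m \<gamma>p)"
    by (intro has_sum_add) simp_all
  moreover have "(\<lambda>\<rho>. ?t \<gamma>m \<rho> + ?t \<gamma>p \<rho>) = lehmer_term \<gamma>m \<gamma>p"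
    by (simp add: lehmer_term_def fun_eq_iff distrib_left)
  ultimately have sum: "(lehmer_term \<gamma>m \<gamma>p has_sum (Sm + Sp - of_real (2 / \<Delta>\<^sup>2))) (other_zeros \<gamma>m \<gamma>p)"
    by (simp add: algebra_simps)
  then have "Re (lehmer_g \<gamma>m \<gamma>p) = Re Sm + Re Sp - 2 / \<Delta>\<^sup>2"
    by (simp add: lehmer_g_def infsumI)
  then have "\<Delta>\<^sup>2 * Re (lehmer_g \<gamma>m \<gamma>p) = \<Delta>\<^sup>2 * (Re Sm + Re Sp) - 2"
    using \<Delta> by (simp add: right_diff_distrib)
  moreover have "\<Delta>\<^sup>2 * (3 * (Re Sm + Re Sp)) < 42 / 5"
  proof -
    have "\<Delta>\<^sup>2 * (3 * (Re Sm + Re Sp)) \<le> \<Delta>\<^sup>2 * Re (- deriv (pre_schwarzian riemann_Xi) ?p - deriv (pre_schwarzian riemann_Xi) ?m)"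
      using Sm(2) Sp(2) by (intro mult_left_mono) auto
    also have "\<dots> < 42 / 5"
      using assms(9) unfolding strong_lehmer_pair_def \<Delta>_def .
    finally show ?thesis .
  qed
  ultimately have "\<Delta>\<^sup>2 * Re (lehmer_g \<gamma>m \<gamma>p) < 4 / 5" by linarith
  then show ?thesis
    using sum by (auto simp: lehmer_pair_def \<Delta>_def has_sum_imp_summable)
qed

end
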